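(* Fix $r\ge1$ and an admissible boundary $(k_{\alpha,j})$ with boundary values $T_{\alpha,j,k_{\alpha,j}}=a_{\alpha,j}$, and let $T$ be the corresponding solution of the $A_r$ $T$-system (see context). Let $(1,j,k)$ satisfy $1+j+k$ even and $k>k_{1,j}$, and set $$j_0=\max\{j'\in\mathbb Z:\ j'-k_{1,j'}=j-k\},\qquad j_1=\min\{j'\in\mathbb Z:\ j'+k_{1,j'}=j+k\}.$$ Then, for any admissible choices of diagonals in the construction of the slice matrices, $$T_{1,j,k}=T_{1,j_1,k_{1,j_1}}\,\big(S_{j_0}S_{j_0+1}\cdots S_{j_1-1}\big)_{1,1}.$$
   Context: $A_r$ $T$-system: for $\alpha\in\{1,\dots,r\}$, $j,k\in\mathbb Z$, $T_{\alpha,j,k+1}T_{\alpha,j,k-1}=T_{\alpha,j+1,k}T_{\alpha,j-1,k}+T_{\alpha+1,j,k}T_{\alpha-1,j,k}$, with $T_{0,j,k}=T_{r+1,j,k}=1$; only points with $\alpha+j+k$ even are considered. Admissible boundary: integers $k_{\alpha,j}$ ($1\le\alpha\le r$, $j\in\mathbb Z$) with $\alpha+j+k_{\alpha,j}$ even, $|k_{\alpha+1,j}-k_{\alpha,j}|=1$ ($1\le\alpha<r$), $|k_{\alpha,j+1}-k_{\alpha,j}|=1$, and such that for some even integer $c$ and integers $J_-\le J_+$, $k_{\alpha,j}=c+((\alpha+j)\bmod2)$ whenever $j<J_-$ or $j>J_+$. The solution with $T_{\alpha,j,k_{\alpha,j}}=a_{\alpha,j}$ is the unique one, viewed as rational functions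 of the $a$'s. Elementary $(r+1)\times(r+1)$ matrices: $H_{\alpha,\alpha+1}(a,b,u)$ is the identity except that its block in rows/columns $\alpha,\alpha+1$ is $\begin{pmatrix}1&0\\ u/b&a/b\end{pmatrix}$; $V_{\alpha,\alpha+1}(x,a,b)$ is the identity except that this block is $\begin{pmatrix}a/b&x/b\\ 0&1\end{pmatrix}$. Slice matrix $S_t$: let $a_\alpha=T_{\alpha,t,k_{\alpha,t}}$, $b_\alpha=T_{\alpha,t+1,k_{\alpha,t+1}}$ ($1\le\alpha\le r$), $a_0=b_0=a_{r+1}=b_{r+1}=1$. For $1\le\alpha\le r-1$, in the square $Q_\alpha$ with corners $(\alpha,t),(\alpha,t+1),(\alpha+1,t),(\alpha+1,t+1)$ choose an admissible diagonal, i.e. one whose endpoints have equal $k$-value: "SW–NE" $=(\alpha,t)$–$(\alpha+1,t+1)$ (admissible iff $k_{\alpha,t}=k_{\alpha+1,t+1}$) or "NW–SE" $=(\alpha,t+1)$–$(\alpha+1,t)$ (admissible iff $k_{\alpha,t+1}=k_{\alpha+1,t}$); at least one is admissible. For each $1\le\alpha\le r$: if $k_{\alpha,t+1}=k_{\alpha,t}+1$, let $X_\alpha=H_{\alpha,\alpha+1}(a_\alpha,b_\alpha,u_\alpha)$ where $u_r=1$ and, for $\alpha<r$, $u_\alpha=b_{\alpha+1}$ if $Q_\alpha$ has the SW–NE diagonal and $u_\alpha=a_{\alpha+1}$ if NW–SE; if $k_{\alpha,t+1}=k_{\alpha,t}-1$, let $X_\alpha=V_{\alpha,\alpha+1}(x_\alpha,a_\alpha,b_\alpha)$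 where $x_1=1$ and, for $\alpha>1$, $x_\alpha=a_{\alpha-1}$ if $Q_{\alpha-1}$ has the SW–NE diagonal and $x_\alpha=b_{\alpha-1}$ if NW–SE. Set $P_1=X_1$ and, for $1\le\alpha\le r-1$, $P_{\alpha+1}=X_{\alpha+1}P_\alpha$ if $Q_\alpha$ has the SW–NE diagonal and $P_{\alpha+1}=P_\alpha X_{\alpha+1}$ if NW–SE. Then $S_t=P_r$. $(M)_{1,1}$ is the top-left entry. *)

theory Defs
  imports
    "Jordan_Normal_Form.Matrix"
    "HOL-Library.Poly_Mapping"
    "HOL-Library.Product_Lexorder"
    "HOL-Computational_Algebra.Fraction_Field"
begin

text \<open>
  The field of rational functions over the rationals in indeterminates indexed by pairs
  \<open>(\<alpha>, j)\<close>: the fraction field of the ring of finitely supported maps from monomials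
  (exponent vectors) to coefficients. The lexicographic order on the index pairs is imported
  only because the integral domain instance for \<open>poly_mapping\<close> requires linearly ordered exponents.
\<close>

type_synonym ratfun = "(((nat \<times> int) \<Rightarrow>\<^sub>0 nat) \<Rightarrow>\<^sub>0 rat) fract"

definition avar :: "nat \<Rightarrow> int \<Rightarrow> ratfun" where
  "avar \<alpha> j = Fract (Poly_Mapping.single (Poly_Mapping.single (\<alpha>, j) 1) 1) 1"

text \<open>
  The relation at \<open>(\<alpha>, j, k)\<close> only involves points whose coordinate sum has the parity of
  \<open>\<alpha> + j + k + 1\<close>. Values of \<open>T\<close> at points with odd coordinate sum are unconstrained.
\<close>

definition T_system :: "nat \<Rightarrow> (nat \<Rightarrow> int \<Rightarrow> int \<Rightarrow> 'a::field) \<Rightarrow> bool" where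
  "T_system r T \<longleftrightarrow>
     (\<forall>\<alpha>\<in>{1..r}. \<forall>j k. odd (int \<alpha> + j + k) \<longrightarrow>
        T \<alpha> j (k + 1) * T \<alpha> j (k - 1) =
          T \<alpha> (j + 1) k * T \<alpha> (j - 1) k + T (\<alpha> + 1) j k * T (\<alpha> - 1) j k) \<and>
     (\<forall>j k. even (j + k) \<longrightarrow> T 0 j k = 1) \<and>
     (\<forall>j k. even (int (r + 1) + j + k) \<longrightarrow> T (r + 1) j k = 1)"

definition admissible_boundary :: "nat \<Rightarrow> (nat \<Rightarrow> int \<Rightarrow> int) \<Rightarrow> bool" where
  "admissible_boundary r kb \<longleftrightarrow>
     (\<forall>\<alpha>\<in>{1..r}. \<forall>j. even (int \<alpha> + j + kb \<alpha> j)) \<and>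
     (\<forall>\<alpha>\<in>{1..<r}. \<forall>j. \<bar>kb (\<alpha> + 1) j - kb \<alpha> j\<bar> = 1) \<and>
     (\<forall>\<alpha>\<in>{1..r}. \<forall>j. \<bar>kb \<alpha> (j + 1) - kb \<alpha> j\<bar> = 1) \<and>
     (\<exists>c J\<^sub>m J\<^sub>p. even c \<and> J\<^sub>m \<le> J\<^sub>p \<and>
        (\<forall>\<alpha>\<in>{1..r}. \<forall>j. j < J\<^sub>m \<or> j > J\<^sub>p \<longrightarrow> kb \<alpha> j = c + (int \<alpha> + j) mod 2))"

text \<open>Matrix indices of the library start at 0, hence the shift.\<close>

definition H_mat :: "nat \<Rightarrow> nat \<Rightarrow> 'a::field \<Rightarrow> 'a \<Rightarrow> 'a \<Rightarrow> 'a mat" where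
  "H_mat r \<alpha> a b u = mat (r + 1) (r + 1) (\<lambda>(i, j).
     if (i + 1, j + 1) = (\<alpha> + 1, \<alpha>) then u / b
     else if (i + 1, j + 1) = (\<alpha> + 1, \<alpha> + 1) then a / b
     else if i = j then 1 else 0)"

definition V_mat :: "nat \<Rightarrow> nat \<Rightarrow> 'a::field \<Rightarrow> 'a \<Rightarrow> 'a \<Rightarrow> 'a mat" where
  "V_mat r \<alpha> x a b = mat (r + 1) (r + 1) (\<lambda>(i, j).
     if (i + 1, j + 1) = (\<alpha>, \<alpha>) then a / b
     else if (i + 1, j + 1) = (\<alpha>, \<alpha> + 1) then x / b
     else if i = j then 1 else 0)"

datatype diagonal = SW_NE | NW_SE

text \<open>\<open>d t \<alpha>\<close> is the diagonal chosen in the square with corners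
  \<open>(\<alpha>, t), (\<alpha>, t + 1), (\<alpha> + 1, t), (\<alpha> + 1, t + 1)\<close>.\<close>

definition admissible_diagonals ::
  "nat \<Rightarrow> (nat \<Rightarrow> int \<Rightarrow> int) \<Rightarrow> (int \<Rightarrow> nat \<Rightarrow> diagonal) \<Rightarrow> bool" where
  "admissible_diagonals r kb d \<longleftrightarrow>
     (\<forall>t. \<forall>\<alpha>\<in>{1..<r}.
        (d t \<alpha> = SW_NE \<longrightarrow> kb \<alpha> t = kb (\<alpha> + 1) (t + 1)) \<and>
        (d t \<alpha> = NW_SE \<longrightarrow> kb \<alpha> (t + 1) = kb (\<alpha> + 1) t))"

definition slice_factor ::
  "nat \<Rightarrow> (nat \<Rightarrow> int \<Rightarrow> int) \<Rightarrow> (nat \<Rightarrow> int \<Rightarrow> int \<Rightarrow> 'a::field) \<Rightarrow> (int \<Rightarrow> nat \<Rightarrow> diagonal)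
    \<Rightarrow> int \<Rightarrow> nat \<Rightarrow> 'a mat" where
  "slice_factor r kb T d t \<alpha> =
     (let a = (\<lambda>\<beta>. T \<beta> t (kb \<beta> t));
          b = (\<lambda>\<beta>. T \<beta> (t + 1) (kb \<beta> (t + 1)));
          u = (if \<alpha> = r then 1 else case d t \<alpha> of SW_NE \<Rightarrow> b (\<alpha> + 1) | NW_SE \<Rightarrow> a (\<alpha> + 1));
          x = (if \<alpha> = 1 then 1 else case d t (\<alpha> - 1) of SW_NE \<Rightarrow> a (\<alpha> - 1) | NW_SE \<Rightarrow> b (\<alpha> - 1))
      in if kb \<alpha> (t + 1) = kb \<alpha> t + 1 then H_mat r \<alpha> (a \<alpha>) (b \<alpha>) u
         else V_mat r \<alpha> x (a \<alpha>) (b \<alpha>))"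

text \<open>The products \<open>P\<^sub>\<alpha>\<close>, \<open>\<alpha> \<ge> 1\<close>; the value at 0 is a dummy.\<close>

fun slice_product ::
  "nat \<Rightarrow> (nat \<Rightarrow> int \<Rightarrow> int) \<Rightarrow> (nat \<Rightarrow> int \<Rightarrow> int \<Rightarrow> 'a::field) \<Rightarrow> (int \<Rightarrow> nat \<Rightarrow> diagonal)
    \<Rightarrow> int \<Rightarrow> nat \<Rightarrow> 'a mat" where
  "slice_product r kb T d t 0 = 1\<^sub>m (r + 1)"
| "slice_product r kb T d t (Suc 0) = slice_factor r kb T d t 1"
| "slice_product r kb T d t (Suc (Suc n)) =
     (case d t (Suc n) of
        SW_NE \<Rightarrow> slice_factor r kb T d t (Suc (Suc n)) * slice_product r kb T d t (Suc n)
      | NW_SE \<Rightarrow> slice_product r kb T d t (Suc n) * slice_factor r kb T d t (Suc (Suc n)))"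

definition slice_matrix ::
  "nat \<Rightarrow> (nat \<Rightarrow> int \<Rightarrow> int) \<Rightarrow> (nat \<Rightarrow> int \<Rightarrow> int \<Rightarrow> 'a::field) \<Rightarrow> (int \<Rightarrow> nat \<Rightarrow> diagonal)
    \<Rightarrow> int \<Rightarrow> 'a mat" where
  "slice_matrix r kb T d t = slice_product r kb T d t r"

end

theory Submission
  imports Defs
begin

text \<open>
  The slice matrices make sense for every stepped surface in the lattice, not just for the given
  boundary. Raising a local minimum \<open>(\<alpha>, t, k)\<close> of a surface to \<open>(\<alpha>, t, k + 2)\<close> replaces a factor
  \<open>V H\<close> of \<open>S\<^bsub>t-1\<^esub> S\<^bsub>t\<^esub>\<close> by \<open>H V\<close>, and the relation \<open>V H = H V\<close> between these matrices is exactly the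
  \<open>T\<close>-system relation; hence the product of the slices is invariant. By such moves the
  boundary, cut off by a tent with apex \<open>(1, j, k)\<close>, is raised to the tent itself. On the
  tent row 1 first rises, where the slices fix the first row vector, and then falls, where they
  scale the first column vector by \<open>T\<^bsub>1,t\<^esub> / T\<^bsub>1,t+1\<^esub>\<close>, so the (1,1) entry telescopes to \<open>T\<^bsub>1,j,k\<^esub>\<close>.
  The same two facts show that the parts of the truncated surface outside \<open>[j\<^sub>0, j\<^sub>1]\<close> do not
  contribute. All divisions are legitimate because the relation is subtraction free, so every
  \<open>T\<close> is a quotient of nonzero polynomials with nonnegative coefficients.
\<close>

section \<open>Positivity of the solutions\<close>

text \<open>A mutation at (\<alpha>, t) changes a height that several slice factors may read, and it
  changes which diagonals are admissible nearby. The way out is that a slice does not depend on the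
  choice of admissible diagonals. The four squares around the vertex may therefore be cut by
  diagonals joining its neighbours; at a local minimum these neighbours have equal heights, so the
  choice is admissible before and after the move. With it, only the two factors of row \<alpha> read
  the vertex, and they meet at the junction of the slices t - 1 and t, so a single identity of 2 x 2
  blocks decides.

  The tent grows by one per row, the steepest growth possible. Hence a surface that lies below it in
  row 1 lies below it in every row, and cutting the boundary off by the tent changes nothing in the
  columns from \<open>j\<^sub>0\<close> to \<open>j\<^sub>1\<close>. Far out the bounded boundary
  lies above the tent, so the cut surface differs from the tent in finitely many points only, and
  finitely many mutations suffice.\<close>

definition stepped_surface :: "nat \<Rightarrow> (nat \<Rightarrow> int \<Rightarrow> int) \<Rightarrow> bool" where
  "stepped_surface r \<kappa> \<longleftrightarrow>
     (\<forall>\<alpha>\<in>{1..r}. \<forall>j. even (int \<alpha> + j + \<kappa> \<alpha> j)) \<and>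
     (\<forall>\<alpha>\<in>{1..<r}. \<forall>j. \<bar>\<kappa> (\<alpha> + 1) j - \<kappa> \<alpha> j\<bar> = 1) \<and>
     (\<forall>\<alpha>\<in>{1..r}. \<forall>j. \<bar>\<kappa> \<alpha> (j + 1) - \<kappa> \<alpha> j\<bar> = 1)"

lemma stepped_surface_parity:
  "stepped_surface r \<kappa> \<Longrightarrow> 1 \<le> \<alpha> \<Longrightarrow> \<alpha> \<le> r \<Longrightarrow> even (int \<alpha> + j + \<kappa> \<alpha> j)"
  by (simp add: stepped_surface_def)

lemma stepped_surface_row_step:
  "stepped_surface r \<kappa> \<Longrightarrow> 1 \<le> \<alpha> \<Longrightarrow> \<alpha> < r \<Longrightarrow> \<bar>\<kappa> (\<alpha> + 1) j - \<kappa> \<alpha> j\<bar> = 1"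
  by (simp add: stepped_surface_def)

lemma stepped_surface_row_step':
  assumes "stepped_surface r \<kappa>" "1 < \<alpha>" "\<alpha> \<le> r"
  shows "\<bar>\<kappa> \<alpha> j - \<kappa> (\<alpha> - 1) j\<bar> = 1"
  using stepped_surface_row_step[OF assms(1), of "\<alpha> - 1" j] assms(2,3) by simp

lemma stepped_surface_column_step:
  "stepped_surface r \<kappa> \<Longrightarrow> 1 \<le> \<alpha> \<Longrightarrow> \<alpha> \<le> r \<Longrightarrow> \<bar>\<kappa> \<alpha> (j + 1) - \<kappa> \<alpha> j\<bar> = 1"
  by (simp add: stepped_surface_def)

lemma stepped_surface_column_step':
  assumes "stepped_surface r \<kappa>" "1 \<le> \<alpha>" "\<alpha> \<le> r"
  shows "\<bar>\<kappa> \<alpha> j - \<kappa> \<alpha> (j - 1)\<bar> = 1"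
  using stepped_surface_column_step[OF assms, of "j - 1"] by simp

lemma stepped_surface_uminus:
  assumes "stepped_surface r \<kappa>"
  shows "stepped_surface r (\<lambda>\<alpha> j. - \<kappa> \<alpha> j)"
  using assms unfolding stepped_surface_def by (simp add: abs_minus_commute)

lemma T_system_relation:
  assumes "T_system r T" "1 \<le> \<alpha>" "\<alpha> \<le> r" "odd (int \<alpha> + j + k)"
  shows "T \<alpha> j (k + 1) * T \<alpha> j (k - 1) =
          T \<alpha> (j + 1) k * T \<alpha> (j - 1) k + T (\<alpha> + 1) j k * T (\<alpha> - 1) j k"
  using assms unfolding T_system_def by simp

text \<open>The relation is symmetric in k + 1 and k - 1. With \<open>stepped_surface_uminus\<close>
  this turns points below a surface into points above one.\<close>

lemma T_system_reflect:
  assumes "T_system r T"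
  shows "T_system r (\<lambda>\<alpha> j k. T \<alpha> j (- k))"
  unfolding T_system_def
proof (intro conjI ballI allI impI)
  fix \<alpha> :: nat and j k :: int
  assume "\<alpha> \<in> {1..r}" "odd (int \<alpha> + j + k)"
  then show "T \<alpha> j (- (k + 1)) * T \<alpha> j (- (k - 1)) =
      T \<alpha> (j + 1) (- k) * T \<alpha> (j - 1) (- k) + T (\<alpha> + 1) j (- k) * T (\<alpha> - 1) j (- k)"
    using T_system_relation[OF assms, of \<alpha> j "- k"]
    by (simp add: mult.commute[of "T \<alpha> j (- k - 1)"])
next
  fix j k :: int assume "even (j + k)"
  then show "T 0 j (- k) = 1" using assms unfolding T_system_def by simp
next
  fix j k :: int assume "even (int (r + 1) + j + k)"
  then have "even (int (r + 1) + j + - k)" by presburger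
  then show "T (r + 1) j (- k) = 1" using assms unfolding T_system_def by blast
qed

text \<open>The \<open>T\<close>-system relation is subtraction free, so it propagates any set closed under
  addition, multiplication and division away from the boundary.\<close>

lemma T_system_cone_above:
  fixes T :: "nat \<Rightarrow> int \<Rightarrow> int \<Rightarrow> 'a::field"
  assumes T: "T_system r T" and \<kappa>: "stepped_surface r \<kappa>"
    and lower: "\<And>\<alpha> i. 1 \<le> \<alpha> \<Longrightarrow> \<alpha> \<le> r \<Longrightarrow> m \<le> \<kappa> \<alpha> i"
    and boundary: "\<And>\<alpha> i. 1 \<le> \<alpha> \<Longrightarrow> \<alpha> \<le> r \<Longrightarrow> T \<alpha> i (\<kappa> \<alpha> i) \<in> P"
    and one: "1 \<in> P" and zero: "0 \<notin> P"
    and add: "\<And>x y. x \<in> P \<Longrightarrow> y \<in> P \<Longrightarrow> x + y \<in> P"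
    and mult: "\<And>x y. x \<in> P \<Longrightarrow> y \<in> P \<Longrightarrow> x * y \<in> P"
    and divide: "\<And>x y. x \<in> P \<Longrightarrow> y \<in> P \<Longrightarrow> x / y \<in> P"
    and "1 \<le> \<alpha>" "\<alpha> \<le> r" "even (int \<alpha> + i + k)" "\<kappa> \<alpha> i \<le> k"
  shows "T \<alpha> i k \<in> P"
  using assms(10-)
\<comment> \<open>The gap \<open>k - \<kappa> \<alpha> i\<close> is no measure: at a neighbour of
  height k - 1 where \<kappa> drops by one, the gap is the same. The uniform bound \<open>m\<close>
  makes the height itself a measure.\<close>
proof (induction "nat (k - m)" arbitrary: \<alpha> i k rule: less_induct)
  case less
  note \<alpha> = less.prems(1,2)
  show ?case
  proof (cases "k = \<kappa> \<alpha> i")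
    case True
    then show ?thesis using boundary[OF \<alpha>] by simp
  next
    case False
    \<comment> \<open>By parity a point off the surface is at least 2 above it. So (\<alpha>, i, k -
      2) and all four neighbours at height k - 1 are still on or above the surface.\<close>
    have k: "\<kappa> \<alpha> i \<le> k - 2"
      using False less.prems(3,4) stepped_surface_parity[OF \<kappa> \<alpha>, of i] by presburger
    have IH: "T \<beta> i' k' \<in> P"
      if "1 \<le> \<beta>" "\<beta> \<le> r" "even (int \<beta> + i' + k')" "\<kappa> \<beta> i' \<le> k'" "k' < k" for \<beta> i' k'
    proof (rule less.hyps)
      show "nat (k' - m) < nat (k - m)" using that(5) lower[OF that(1,2), of i'] that(4) by simp
    qed (use that in auto)
    have *: "T \<alpha> i (k - 2) \<in> P" using less.prems k by (intro IH) auto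
    have "T \<alpha> (i + 1) (k - 1) \<in> P"
      using less.prems k stepped_surface_column_step[OF \<kappa> \<alpha>, of i] by (intro IH) auto
    moreover have "T \<alpha> (i - 1) (k - 1) \<in> P"
      using less.prems k stepped_surface_column_step'[OF \<kappa> \<alpha>, of i] by (intro IH) auto
    moreover have "T (\<alpha> + 1) i (k - 1) \<in> P"
    proof (cases "\<alpha> = r")
      case True
      have "even (int (r + 1) + i + (k - 1))" using less.prems(3) True by presburger
      then have "T (r + 1) i (k - 1) = 1" using T unfolding T_system_def by blast
      then show ?thesis using True one by simp
    next
      case False
      then show ?thesis
        using less.prems k stepped_surface_row_step[OF \<kappa> \<alpha>(1), of i] by (intro IH) auto
    qed
    moreover have "T (\<alpha> - 1) i (k - 1) \<in> P"
    proof (cases "\<alpha> = 1")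
      case True
      have "even (i + (k - 1))" using less.prems(3) True by presburger
      then have "T 0 i (k - 1) = 1" using T unfolding T_system_def by blast
      then show ?thesis using True one by simp
    next
      case False
      then show ?thesis
        using less.prems k stepped_surface_row_step'[OF \<kappa> _ \<alpha>(2), of i] by (intro IH) auto
    qed
    moreover have "T \<alpha> i k * T \<alpha> i (k - 2) =
        T \<alpha> (i + 1) (k - 1) * T \<alpha> (i - 1) (k - 1) + T (\<alpha> + 1) i (k - 1) * T (\<alpha> - 1) i (k - 1)"
      using T_system_relation[OF T \<alpha>, of i "k - 1"] less.prems(3) by simp
    ultimately have "T \<alpha> i k * T \<alpha> i (k - 2) \<in> P" by (simp only: add mult)
    from this * have "T \<alpha> i k * T \<alpha> i (k - 2) / T \<alpha> i (k - 2) \<in> P" by (rule divide)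
    moreover have "T \<alpha> i (k - 2) \<noteq> 0" using * zero by metis
    ultimately show ?thesis by simp
  qed
qed

lemma T_system_cone:
  fixes T :: "nat \<Rightarrow> int \<Rightarrow> int \<Rightarrow> 'a::field"
  assumes T: "T_system r T" and \<kappa>: "stepped_surface r \<kappa>"
    and lower: "\<And>\<alpha> i. 1 \<le> \<alpha> \<Longrightarrow> \<alpha> \<le> r \<Longrightarrow> m \<le> \<kappa> \<alpha> i"
    and upper: "\<And>\<alpha> i. 1 \<le> \<alpha> \<Longrightarrow> \<alpha> \<le> r \<Longrightarrow> \<kappa> \<alpha> i \<le> M"
    and boundary: "\<And>\<alpha> i. 1 \<le> \<alpha> \<Longrightarrow> \<alpha> \<le> r \<Longrightarrow> T \<alpha> i (\<kappa> \<alpha> i) \<in> P"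
    and cone: "1 \<in> P" "0 \<notin> P"
      "\<And>x y. x \<in> P \<Longrightarrow> y \<in> P \<Longrightarrow> x + y \<in> P"
      "\<And>x y. x \<in> P \<Longrightarrow> y \<in> P \<Longrightarrow> x * y \<in> P"
      "\<And>x y. x \<in> P \<Longrightarrow> y \<in> P \<Longrightarrow> x / y \<in> P"
    and \<alpha>: "1 \<le> \<alpha>" "\<alpha> \<le> r" "even (int \<alpha> + i + k)"
  shows "T \<alpha> i k \<in> P"
proof (cases "\<kappa> \<alpha> i \<le> k")
  case True
  show ?thesis
    by (rule T_system_cone_above[OF T \<kappa>]) (fact lower boundary cone \<alpha> True)+
next
  case False
  \<comment> \<open>A point below the surface is handled in the reflected system, where
    \<open>- M\<close> serves as the uniform lower bound.\<close>
  have "T \<alpha> i (- (- k)) \<in> P"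
  proof (rule T_system_cone_above[OF T_system_reflect[OF T] stepped_surface_uminus[OF \<kappa>]])
    show "- M \<le> - \<kappa> \<beta> i'" if "1 \<le> \<beta>" "\<beta> \<le> r" for \<beta> i' using upper[OF that] by simp
    show "T \<beta> i' (- (- \<kappa> \<beta> i')) \<in> P" if "1 \<le> \<beta>" "\<beta> \<le> r" for \<beta> i' using boundary[OF that] by simp
    show "even (int \<alpha> + i + - k)" "- \<kappa> \<alpha> i \<le> - k" using \<alpha>(3) False by simp_all
  qed (fact cone \<alpha>)+
  then show ?thesis by simp
qed

section \<open>Quotients of polynomials with nonnegative coefficients\<close>

definition nonneg_polys :: "('a::monoid_add \<Rightarrow>\<^sub>0 'b::linordered_idom) set" where
  "nonneg_polys = {p. p \<noteq> 0 \<and> (\<forall>m. 0 \<le> Poly_Mapping.lookup p m)}"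

lemma nonneg_polys_single: "c > 0 \<Longrightarrow> Poly_Mapping.single m c \<in> nonneg_polys"
  unfolding nonneg_polys_def by (auto simp: lookup_single when_def)
    (metis lookup_single_eq lookup_zero less_irrefl)

text \<open>Nonnegative coefficients cannot cancel: a monomial of \<open>p\<close> with positive
  coefficient keeps a positive one in the sum.\<close>

lemma nonneg_polys_add:
  assumes "p \<in> nonneg_polys" "q \<in> nonneg_polys"
  shows "p + q \<in> nonneg_polys"
proof -
  obtain m where "Poly_Mapping.lookup p m \<noteq> 0"
    using assms(1) by (auto simp: nonneg_polys_def poly_mapping_eq_iff fun_eq_iff)
  then have "Poly_Mapping.lookup p m > 0" "Poly_Mapping.lookup q m \<ge> 0"
    using assms by (auto simp: nonneg_polys_def less_le)
  then have "Poly_Mapping.lookup (p + q) m \<noteq> 0" by (simp add: lookup_add)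
  then have "p + q \<noteq> 0" by auto
  then show ?thesis using assms by (auto simp: nonneg_polys_def lookup_add)
qed

text \<open>Each coefficient of the product is a sum of products of nonnegative ones; the product is
  nonzero because the ring is an integral domain.\<close>

lemma nonneg_polys_mult:
  fixes p q :: "'a::{ordered_cancel_comm_monoid_add, linorder} \<Rightarrow>\<^sub>0 'b::linordered_idom"
  assumes "p \<in> nonneg_polys" "q \<in> nonneg_polys"
  shows "p * q \<in> nonneg_polys"
proof -
  have "0 \<le> Poly_Mapping.lookup (p * q) m" for m
    using assms
    by (auto simp: nonneg_polys_def times_poly_mapping.rep_eq prod_fun_def Sum_any.expand_set when_def
        intro!: sum_nonneg mult_nonneg_nonneg)
  then show ?thesis using assms by (auto simp: nonneg_polys_def)
qed

text \<open>The cone \<open>P\<close> to which \<open>T_system_cone\<close> is applied. It asks for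
  some representation with nonnegative coefficients, not a reduced one: (x^3 + 1)/(x + 1) belongs to
  it although it equals x^2 - x + 1.\<close>

definition positive_fracts :: "('a::{ordered_cancel_comm_monoid_add, linorder} \<Rightarrow>\<^sub>0 'b::linordered_idom) fract set" where
  "positive_fracts = {Fract p q | p q. p \<in> nonneg_polys \<and> q \<in> nonneg_polys}"

lemma nonneg_polys_nonzero: "p \<in> nonneg_polys \<Longrightarrow> p \<noteq> 0"
  by (simp add: nonneg_polys_def)

lemma positive_fractsI:
  "p \<in> nonneg_polys \<Longrightarrow> q \<in> nonneg_polys \<Longrightarrow> Fract p q \<in> positive_fracts"
  unfolding positive_fracts_def by blast

lemma positive_fractsE:
  assumes "x \<in> positive_fracts"
  obtains p q where "x = Fract p q" "p \<in> nonneg_polys" "q \<in> nonneg_polys" "q \<noteq> 0"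
  using assms nonneg_polys_nonzero unfolding positive_fracts_def by blast

lemma zero_notin_positive_fracts: "0 \<notin> positive_fracts"
proof
  assume "0 \<in> (positive_fracts :: ('a \<Rightarrow>\<^sub>0 'b) fract set)"
  then obtain p q :: "'a \<Rightarrow>\<^sub>0 'b" where "0 = Fract p q" "p \<noteq> 0" "q \<noteq> 0"
    by (metis positive_fractsE nonneg_polys_nonzero)
  then show False by (simp add: Zero_fract_def eq_fract)
qed

lemma one_in_nonneg_polys: "1 \<in> nonneg_polys"
  using nonneg_polys_single[of 1 0] by simp

lemma one_in_positive_fracts: "1 \<in> positive_fracts"
  unfolding One_fract_def by (intro positive_fractsI one_in_nonneg_polys)

lemma positive_fracts_add:
  assumes "x \<in> positive_fracts" "y \<in> positive_fracts"
  shows "x + y \<in> positive_fracts"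
  using assms
  by (elim positive_fractsE) (simp add: positive_fractsI nonneg_polys_add nonneg_polys_mult)

lemma positive_fracts_mult:
  assumes "x \<in> positive_fracts" "y \<in> positive_fracts"
  shows "x * y \<in> positive_fracts"
  using assms by (elim positive_fractsE) (simp add: positive_fractsI nonneg_polys_mult)

lemma positive_fracts_divide:
  assumes "x \<in> positive_fracts" "y \<in> positive_fracts"
  shows "x / y \<in> positive_fracts"
  using assms by (elim positive_fractsE) (simp add: positive_fractsI nonneg_polys_mult)

lemma avar_in_positive_fracts: "avar \<alpha> j \<in> positive_fracts"
  unfolding avar_def by (intro positive_fractsI one_in_nonneg_polys nonneg_polys_single) simp

section \<open>Block matrices\<close>

text \<open>Common shape of \<open>H_mat\<close> and \<open>V_mat\<close>, so that products and
  commutation are proved once. In indices from 0 the block occupies \<alpha> - 1 and \<alpha>;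
  writing i + 1 = \<alpha> avoids subtraction on naturals.\<close>

definition block_mat :: "nat \<Rightarrow> nat \<Rightarrow> 'a::field \<Rightarrow> 'a \<Rightarrow> 'a \<Rightarrow> 'a \<Rightarrow> 'a mat" where
  "block_mat r \<alpha> p q s w = mat (r + 1) (r + 1) (\<lambda>(i, j).
     if i + 1 = \<alpha> \<and> j + 1 = \<alpha> then p
     else if i + 1 = \<alpha> \<and> j = \<alpha> then q
     else if i = \<alpha> \<and> j + 1 = \<alpha> then s
     else if i = \<alpha> \<and> j = \<alpha> then w
     else if i = j then 1 else 0)"

lemma block_mat_carrier [simp]: "block_mat r \<alpha> p q s w \<in> carrier_mat (r + 1) (r + 1)"
  by (simp add: block_mat_def)

lemma block_mat_index:
  "i < r + 1 \<Longrightarrow> j < r + 1 \<Longrightarrow> block_mat r \<alpha> p q s w $$ (i, j) =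
    (if i + 1 = \<alpha> then if j + 1 = \<alpha> then p else if j = \<alpha> then q else 0
     else if i = \<alpha> then if j + 1 = \<alpha> then s else if j = \<alpha> then w else 0
     else if i = j then 1 else 0)"
  by (auto simp: block_mat_def)

lemma H_mat_eq_block_mat: "1 \<le> \<alpha> \<Longrightarrow> H_mat r \<alpha> a b u = block_mat r \<alpha> 1 0 (u / b) (a / b)"
  by (rule eq_matI) (auto simp: H_mat_def block_mat_def)

lemma V_mat_eq_block_mat: "1 \<le> \<alpha> \<Longrightarrow> V_mat r \<alpha> x a b = block_mat r \<alpha> (a / b) (x / b) 0 1"
  by (rule eq_matI) (auto simp: V_mat_def block_mat_def)

text \<open>Left multiplication by a block only mixes the rows \<alpha> - 1 and \<alpha>. This
  reduces the matrix identities below to a case distinction on the row.\<close>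

lemma block_mat_mult_index:
  assumes "1 \<le> \<alpha>" "\<alpha> \<le> r" "M \<in> carrier_mat (r + 1) (r + 1)" "i < r + 1" "j < r + 1"
  shows "(block_mat r \<alpha> p q s w * M) $$ (i, j) =
    (if i + 1 = \<alpha> then p * M $$ (i, j) + q * M $$ (\<alpha>, j)
     else if i = \<alpha> then s * M $$ (\<alpha> - 1, j) + w * M $$ (\<alpha>, j)
     else M $$ (i, j))"
proof -
  have *: "(block_mat r \<alpha> p q s w * M) $$ (i, j) =
      (\<Sum>l\<in>{0..<r+1}. block_mat r \<alpha> p q s w $$ (i, l) * M $$ (l, j))"
    using assms by (simp add: block_mat_def scalar_prod_def)
  show ?thesis
  proof (cases "i + 1 = \<alpha> \<or> i = \<alpha>")
    case True
    have "(\<Sum>l\<in>{0..<r+1}. block_mat r \<alpha> p q s w $$ (i, l) * M $$ (l, j)) =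
        (\<Sum>l\<in>{\<alpha> - 1, \<alpha>}. block_mat r \<alpha> p q s w $$ (i, l) * M $$ (l, j))"
      using True assms by (intro sum.mono_neutral_right) (auto simp: block_mat_def)
    then show ?thesis using True assms * by (auto simp: block_mat_def)
  next
    case False
    have "(\<Sum>l\<in>{0..<r+1}. block_mat r \<alpha> p q s w $$ (i, l) * M $$ (l, j)) =
        (\<Sum>l\<in>{i}. block_mat r \<alpha> p q s w $$ (i, l) * M $$ (l, j))"
      using False assms by (intro sum.mono_neutral_right) (auto simp: block_mat_def)
    then show ?thesis using False assms * by (auto simp: block_mat_def)
  qed
qed

lemma block_mat_mult_same:
  assumes "1 \<le> \<alpha>" "\<alpha> \<le> r"
  shows "block_mat r \<alpha> p q s w * block_mat r \<alpha> p' q' s' w' =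
    block_mat r \<alpha> (p * p' + q * s') (p * q' + q * w') (s * p' + w * s') (s * q' + w * w')"
proof (rule eq_matI)
  fix i j
  assume "i < dim_row (block_mat r \<alpha> (p * p' + q * s') (p * q' + q * w') (s * p' + w * s') (s * q' + w * w'))"
    and "j < dim_col (block_mat r \<alpha> (p * p' + q * s') (p * q' + q * w') (s * p' + w * s') (s * q' + w * w'))"
  then have ij: "i < r + 1" "j < r + 1" by (auto simp: block_mat_def)
  show "(block_mat r \<alpha> p q s w * block_mat r \<alpha> p' q' s' w') $$ (i, j) =
    block_mat r \<alpha> (p * p' + q * s') (p * q' + q * w') (s * p' + w * s') (s * q' + w * w') $$ (i, j)"
    unfolding block_mat_mult_index[OF assms block_mat_carrier ij]
    using ij assms
    by (cases "i + 1 = \<alpha>"; cases "i = \<alpha>"; simp add: block_mat_index)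
qed (auto simp: block_mat_def)

text \<open>The index pairs {\<alpha> - 1, \<alpha>} and {\<beta> - 1, \<beta>} are
  disjoint.\<close>

lemma block_mat_commute_less:
  assumes \<alpha>: "1 \<le> \<alpha>" "\<alpha> + 1 < \<beta>" "\<beta> \<le> r"
  shows "block_mat r \<alpha> p q s w * block_mat r \<beta> p' q' s' w' =
    block_mat r \<beta> p' q' s' w' * block_mat r \<alpha> p q s w" (is "?L = ?R")
proof (rule eq_matI)
  fix i j
  assume "i < dim_row ?R" and "j < dim_col ?R"
  then have ij: "i < r + 1" "j < r + 1" by (auto simp: block_mat_def)
  have ranges: "\<alpha> \<le> r" "1 \<le> \<beta>" using assms by auto
  consider "i + 1 = \<alpha>" | "i = \<alpha>" | "i + 1 = \<beta>" | "i = \<beta>"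
    | "i + 1 \<noteq> \<alpha>" "i \<noteq> \<alpha>" "i + 1 \<noteq> \<beta>" "i \<noteq> \<beta>" by blast
  then show "?L $$ (i, j) = ?R $$ (i, j)"
    unfolding block_mat_mult_index[OF \<alpha>(1) ranges(1) block_mat_carrier ij]
      block_mat_mult_index[OF ranges(2) \<alpha>(3) block_mat_carrier ij]
    using ij assms by cases (simp_all add: block_mat_index, arith+)
qed (auto simp: block_mat_def)

lemma block_mat_commute:
  assumes "1 \<le> \<alpha>" "\<alpha> \<le> r" "1 \<le> \<beta>" "\<beta> \<le> r" "\<alpha> + 1 < \<beta> \<or> \<beta> + 1 < \<alpha>"
  shows "block_mat r \<alpha> p q s w * block_mat r \<beta> p' q' s' w' =
    block_mat r \<beta> p' q' s' w' * block_mat r \<alpha> p q s w"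
  using assms(5)
proof
  assume "\<alpha> + 1 < \<beta>"
  then show ?thesis by (rule block_mat_commute_less[OF assms(1) _ assms(4)])
next
  assume "\<beta> + 1 < \<alpha>"
  then show ?thesis by (rule block_mat_commute_less[OF assms(3) _ assms(2), symmetric])
qed

text \<open>Adjacent blocks V and H share the index \<alpha>, and only the row of that index depends
  on their order: it is (p s, p w, q) on the left and (s', w p, w q') on the right. The two
  equations match these entries; they are the change of \<open>u\<close> and \<open>x\<close> caused
  by exchanging the diagonal.\<close>

lemma block_mat_lower_upper_flip:
  assumes \<alpha>: "1 \<le> \<alpha>" "\<alpha> + 1 \<le> r" and "s' = p * s" "q = w * q'"
  shows "block_mat r (\<alpha> + 1) p q 0 1 * block_mat r \<alpha> 1 0 s w =
    block_mat r \<alpha> 1 0 s' w * block_mat r (\<alpha> + 1) p q' 0 1" (is "?L = ?R")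
proof (rule eq_matI)
  fix i j
  assume "i < dim_row ?R" and "j < dim_col ?R"
  then have ij: "i < r + 1" "j < r + 1" by (auto simp: block_mat_def)
  have \<alpha>': "1 \<le> \<alpha> + 1" "\<alpha> \<le> r" using \<alpha> by auto
  show "?L $$ (i, j) = ?R $$ (i, j)"
    unfolding block_mat_mult_index[OF \<alpha>(1) \<alpha>'(2) block_mat_carrier ij]
      block_mat_mult_index[OF \<alpha>'(1) \<alpha>(2) block_mat_carrier ij]
    using ij assms
    by (cases "i + 1 = \<alpha>"; cases "i = \<alpha>"; cases "i = \<alpha> + 1"; auto simp: block_mat_index)
qed (auto simp: block_mat_def)

text \<open>Here both blocks have the identity row at the shared index \<alpha>, so neither changes
  the row that the other one reads.\<close>

lemma block_mat_upper_lower_commute: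
  assumes \<alpha>: "1 \<le> \<alpha>" "\<alpha> + 1 \<le> r"
  shows "block_mat r (\<alpha> + 1) 1 0 s w * block_mat r \<alpha> p q 0 1 =
    block_mat r \<alpha> p q 0 1 * block_mat r (\<alpha> + 1) 1 0 s w" (is "?L = ?R")
proof (rule eq_matI)
  fix i j
  assume "i < dim_row ?R" and "j < dim_col ?R"
  then have ij: "i < r + 1" "j < r + 1" by (auto simp: block_mat_def)
  have \<alpha>': "1 \<le> \<alpha> + 1" "\<alpha> \<le> r" using \<alpha> by auto
  show "?L $$ (i, j) = ?R $$ (i, j)"
    unfolding block_mat_mult_index[OF \<alpha>(1) \<alpha>'(2) block_mat_carrier ij]
      block_mat_mult_index[OF \<alpha>'(1) \<alpha>(2) block_mat_carrier ij]
    using ij assms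
    by (cases "i + 1 = \<alpha>"; cases "i = \<alpha>"; cases "i = \<alpha> + 1"; auto simp: block_mat_index)
qed (auto simp: block_mat_def)

section \<open>Products ordered by diagonals\<close>

lemma square_mat_left_commute:
  assumes "A \<in> carrier_mat n n" "B \<in> carrier_mat n n" "C \<in> carrier_mat n n" "A * B = B * A"
  shows "A * (B * C) = B * (A * C)"
  using assoc_mult_mat[OF assms(1-3)] assoc_mult_mat[OF assms(2,1,3)] assms(4) by simp

lemma square_mat_right_commute:
  assumes "A \<in> carrier_mat n n" "B \<in> carrier_mat n n" "C \<in> carrier_mat n n" "A * B = B * A"
  shows "C * A * B = C * B * A"
  using assoc_mult_mat[OF assms(3,1,2)] assoc_mult_mat[OF assms(3,2,1)] assms(4) by simp

text \<open>The recursion of \<open>slice_product\<close> for arbitrary factors, which allows single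
  factors to be replaced by the identity. Starting from the identity avoids a special case at 1,
  since both orders then give \<open>X 1\<close>.\<close>

fun ordered_product :: "nat \<Rightarrow> (nat \<Rightarrow> 'a::field mat) \<Rightarrow> (nat \<Rightarrow> diagonal) \<Rightarrow> nat \<Rightarrow> 'a mat" where
  "ordered_product N X \<delta> 0 = 1\<^sub>m N"
| "ordered_product N X \<delta> (Suc n) =
     (if \<delta> n = SW_NE then X (Suc n) * ordered_product N X \<delta> n
      else ordered_product N X \<delta> n * X (Suc n))"

lemma ordered_product_carrier:
  assumes "\<And>\<beta>. 1 \<le> \<beta> \<Longrightarrow> \<beta> \<le> n \<Longrightarrow> X \<beta> \<in> carrier_mat N N"
  shows "ordered_product N X \<delta> n \<in> carrier_mat N N"
  using assms by (induction n) (auto intro!: mult_carrier_mat[of _ N N])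

lemma ordered_product_cong:
  assumes "\<And>\<beta>. 1 \<le> \<beta> \<Longrightarrow> \<beta> \<le> n \<Longrightarrow> X \<beta> = X' \<beta>" "\<And>\<beta>. 1 \<le> \<beta> \<Longrightarrow> \<beta> < n \<Longrightarrow> \<delta> \<beta> = \<delta>' \<beta>"
    and "\<And>\<beta>. 1 \<le> \<beta> \<Longrightarrow> \<beta> \<le> n \<Longrightarrow> X \<beta> \<in> carrier_mat N N"
  shows "ordered_product N X \<delta> n = ordered_product N X' \<delta>' n"
  using assms
proof (induction n)
  case (Suc n)
  have IH: "ordered_product N X \<delta> n = ordered_product N X' \<delta>' n"
    by (rule Suc.IH) (use Suc.prems in auto)
  have X: "X (Suc n) = X' (Suc n)" using Suc.prems(1)[of "Suc n"] by simp
  show ?case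
  proof (cases "n = 0")
    case True
    then show ?thesis using X Suc.prems(3)[of "Suc 0"] by auto
  next
    case False
    then show ?thesis using IH X Suc.prems(2)[of n] by simp
  qed
qed simp

lemma slice_product_eq_ordered_product:
  assumes "\<And>\<beta>. 1 \<le> \<beta> \<Longrightarrow> \<beta> \<le> n \<Longrightarrow> slice_factor r \<kappa> T d t \<beta> \<in> carrier_mat (r + 1) (r + 1)"
  shows "slice_product r \<kappa> T d t n = ordered_product (r + 1) (slice_factor r \<kappa> T d t) (d t) n"
  using assms
proof (induction n)
  case (Suc n)
  show ?case
  proof (cases n)
    case 0
    then show ?thesis using Suc.prems[of 1] by simp
  next
    case [simp]: (Suc m)
    have "slice_product r \<kappa> T d t n = ordered_product (r + 1) (slice_factor r \<kappa> T d t) (d t) n"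
      by (rule Suc.IH) (use Suc.prems in auto)
    then show ?thesis by (simp split: diagonal.splits)
  qed
qed simp

lemma commute_ordered_product:
  assumes "Y \<in> carrier_mat N N"
    and "\<And>\<beta>. 1 \<le> \<beta> \<Longrightarrow> \<beta> \<le> n \<Longrightarrow> X \<beta> \<in> carrier_mat N N"
    and "\<And>\<beta>. 1 \<le> \<beta> \<Longrightarrow> \<beta> \<le> n \<Longrightarrow> Y * X \<beta> = X \<beta> * Y"
  shows "Y * ordered_product N X \<delta> n = ordered_product N X \<delta> n * Y"
  using assms
proof (induction n)
  case (Suc n)
  let ?P = "ordered_product N X \<delta> n"
  have IH: "Y * ?P = ?P * Y" by (rule Suc.IH) (use Suc.prems in auto)
  have P: "?P \<in> carrier_mat N N" by (rule ordered_product_carrier) (use Suc.prems in auto)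
  have X: "X (Suc n) \<in> carrier_mat N N" "Y * X (Suc n) = X (Suc n) * Y" using Suc.prems by auto
  note Y = Suc.prems(1)
  have "Y * (X (Suc n) * ?P) = X (Suc n) * ?P * Y"
    using square_mat_left_commute[OF Y X(1) P X(2)] IH assoc_mult_mat[OF X(1) P Y] by simp
  moreover have "Y * (?P * X (Suc n)) = ?P * X (Suc n) * Y"
    using square_mat_left_commute[OF Y P X(1) IH] X(2) assoc_mult_mat[OF P X(1) Y] by simp
  ultimately show ?case by simp
qed simp

text \<open>The diagonal of the square before \<alpha> puts \<open>X \<alpha>\<close> left of all
  earlier factors, the next one puts \<open>X (\<alpha> + 1)\<close> on the right, and all later
  factors commute with \<open>X \<alpha>\<close>. Putting the identity in its place keeps the rest
  an ordered product, to which \<open>ordered_product_cong\<close> applies.\<close>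

lemma ordered_product_extract_left:
  assumes X: "\<And>\<beta>. 1 \<le> \<beta> \<Longrightarrow> \<beta> \<le> n \<Longrightarrow> X \<beta> \<in> carrier_mat N N"
    and comm: "\<And>\<beta>. \<alpha> + 1 < \<beta> \<Longrightarrow> \<beta> \<le> n \<Longrightarrow> X \<beta> * X \<alpha> = X \<alpha> * X \<beta>"
    and \<alpha>: "1 \<le> \<alpha>" "\<alpha> \<le> n"
    and "\<alpha> > 1 \<Longrightarrow> \<delta> (\<alpha> - 1) = SW_NE" and "\<alpha> < n \<Longrightarrow> \<delta> \<alpha> = NW_SE"
  shows "ordered_product N X \<delta> n = X \<alpha> * ordered_product N (X(\<alpha> := 1\<^sub>m N)) \<delta> n"
  using assms
proof (induction n)
  case (Suc n)
  let ?X = "X(\<alpha> := 1\<^sub>m N)"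
  have X': "?X \<beta> \<in> carrier_mat N N" if "1 \<le> \<beta>" "\<beta> \<le> Suc n" for \<beta> using Suc.prems(1) that by auto
  let ?P = "ordered_product N ?X \<delta> n"
  have P: "?P \<in> carrier_mat N N" by (rule ordered_product_carrier) (use X' in auto)
  have X\<alpha>: "X \<alpha> \<in> carrier_mat N N" using Suc.prems by auto
  show ?case
  proof (cases "\<alpha> = Suc n")
    case True
    have *: "ordered_product N X \<delta> n = ?P"
      by (rule ordered_product_cong) (use Suc.prems True in auto)
    show ?thesis
    proof (cases "n = 0")
      case T0: True
      then show ?thesis using True * X\<alpha> by auto
    next
      case False
      then have "\<delta> n = SW_NE" using Suc.prems(5) True by simp
      then show ?thesis using True * P by (simp add: fun_upd_def)
    qed
  next
    case False
    then have IH: "ordered_product N X \<delta> n = X \<alpha> * ?P"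
      by (intro Suc.IH) (use Suc.prems in auto)
    have XS: "X (Suc n) \<in> carrier_mat N N" using Suc.prems by auto
    show ?thesis
    proof (cases "\<delta> n = SW_NE")
      case True
      then have "\<alpha> \<noteq> n" using Suc.prems(6) False by auto
      then have "X (Suc n) * X \<alpha> = X \<alpha> * X (Suc n)" using Suc.prems(2,4) False by auto
      then have "X (Suc n) * (X \<alpha> * ?P) = X \<alpha> * (X (Suc n) * ?P)"
        by (rule square_mat_left_commute[OF XS X\<alpha> P])
      then show ?thesis using True False IH by (simp add: fun_upd_def)
    next
      case F: False
      have "X \<alpha> * ?P * X (Suc n) = X \<alpha> * (?P * X (Suc n))"
        by (rule assoc_mult_mat[OF X\<alpha> P XS])
      then show ?thesis using F False IH by (simp add: fun_upd_def)
    qed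
  qed
qed simp

lemma ordered_product_extract_right:
  assumes X: "\<And>\<beta>. 1 \<le> \<beta> \<Longrightarrow> \<beta> \<le> n \<Longrightarrow> X \<beta> \<in> carrier_mat N N"
    and comm: "\<And>\<beta>. \<alpha> + 1 < \<beta> \<Longrightarrow> \<beta> \<le> n \<Longrightarrow> X \<beta> * X \<alpha> = X \<alpha> * X \<beta>"
    and \<alpha>: "1 \<le> \<alpha>" "\<alpha> \<le> n"
    and "\<alpha> > 1 \<Longrightarrow> \<delta> (\<alpha> - 1) = NW_SE" and "\<alpha> < n \<Longrightarrow> \<delta> \<alpha> = SW_NE"
  shows "ordered_product N X \<delta> n = ordered_product N (X(\<alpha> := 1\<^sub>m N)) \<delta> n * X \<alpha>"
  using assms
proof (induction n)
  case (Suc n)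
  let ?X = "X(\<alpha> := 1\<^sub>m N)"
  have X': "?X \<beta> \<in> carrier_mat N N" if "1 \<le> \<beta>" "\<beta> \<le> Suc n" for \<beta> using Suc.prems(1) that by auto
  let ?P = "ordered_product N ?X \<delta> n"
  have P: "?P \<in> carrier_mat N N" by (rule ordered_product_carrier) (use X' in auto)
  have X\<alpha>: "X \<alpha> \<in> carrier_mat N N" using Suc.prems by auto
  show ?case
  proof (cases "\<alpha> = Suc n")
    case True
    have *: "ordered_product N X \<delta> n = ?P"
      by (rule ordered_product_cong) (use Suc.prems True in auto)
    show ?thesis
    proof (cases "n = 0")
      case T0: True
      then show ?thesis using True * X\<alpha> by auto
    next
      case False
      then have "\<delta> n = NW_SE" using Suc.prems(5) True by simp
      then show ?thesis using True * P by (simp add: fun_upd_def)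
    qed
  next
    case False
    then have IH: "ordered_product N X \<delta> n = ?P * X \<alpha>"
      by (intro Suc.IH) (use Suc.prems in auto)
    have XS: "X (Suc n) \<in> carrier_mat N N" using Suc.prems by auto
    show ?thesis
    proof (cases "\<delta> n = NW_SE")
      case True
      then have "\<alpha> \<noteq> n" using Suc.prems(6) False by auto
      then have "X (Suc n) * X \<alpha> = X \<alpha> * X (Suc n)" using Suc.prems(2,4) False by auto
      then have "?P * X (Suc n) * X \<alpha> = ?P * X \<alpha> * X (Suc n)"
        by (rule square_mat_right_commute[OF XS X\<alpha> P])
      then show ?thesis using True False IH by (simp add: fun_upd_def)
    next
      case F: False
      have "X (Suc n) * ?P * X \<alpha> = X (Suc n) * (?P * X \<alpha>)"
        by (rule assoc_mult_mat[OF XS P X\<alpha>])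
      moreover have "\<delta> n = SW_NE" using F by (cases "\<delta> n") auto
      ultimately show ?thesis using False IH by (simp add: fun_upd_def)
    qed
  qed
qed simp

text \<open>The entry of \<delta> at \<alpha> only decides the order of the factors \<alpha> and
  \<alpha> + 1. Since factor \<alpha> + 1 commutes with everything before \<alpha>, the two can be
  made adjacent and exchanged by \<open>flip\<close>; later steps agree on both sides.\<close>

lemma ordered_product_flip:
  assumes X: "\<And>\<beta>. 1 \<le> \<beta> \<Longrightarrow> \<beta> \<le> n \<Longrightarrow> X \<beta> \<in> carrier_mat N N"
    and X': "\<And>\<beta>. 1 \<le> \<beta> \<Longrightarrow> \<beta> \<le> n \<Longrightarrow> X' \<beta> \<in> carrier_mat N N"
    and XX': "\<And>\<beta>. 1 \<le> \<beta> \<Longrightarrow> \<beta> \<le> n \<Longrightarrow> \<beta> \<noteq> \<alpha> \<Longrightarrow> \<beta> \<noteq> \<alpha> + 1 \<Longrightarrow> X \<beta> = X' \<beta>"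
    and \<delta>\<delta>': "\<And>\<beta>. 1 \<le> \<beta> \<Longrightarrow> \<beta> < n \<Longrightarrow> \<beta> \<noteq> \<alpha> \<Longrightarrow> \<delta> \<beta> = \<delta>' \<beta>"
    and comm: "\<And>\<beta>. 1 \<le> \<beta> \<Longrightarrow> \<beta> < \<alpha> \<Longrightarrow> X (\<alpha> + 1) * X \<beta> = X \<beta> * X (\<alpha> + 1)"
      "\<And>\<beta>. 1 \<le> \<beta> \<Longrightarrow> \<beta> < \<alpha> \<Longrightarrow> X' (\<alpha> + 1) * X \<beta> = X \<beta> * X' (\<alpha> + 1)"
    and \<alpha>: "1 \<le> \<alpha>" "\<alpha> + 1 \<le> n"
    and \<delta>: "\<delta> \<alpha> = SW_NE" "\<delta>' \<alpha> = NW_SE"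
    and flip: "X (\<alpha> + 1) * X \<alpha> = X' \<alpha> * X' (\<alpha> + 1)"
  shows "ordered_product N X \<delta> n = ordered_product N X' \<delta>' n"
  using \<alpha>(2) X X' XX' \<delta>\<delta>'
proof (induction n rule: dec_induct)
  case base
  obtain m where m: "\<alpha> = Suc m" using \<alpha> by (cases \<alpha>) auto
  let ?P = "ordered_product N X \<delta> m"
  have P: "?P \<in> carrier_mat N N" by (rule ordered_product_carrier) (use base m in auto)
  have P': "ordered_product N X' \<delta>' m = ?P"
    by (rule ordered_product_cong[symmetric]) (use base m in auto)
  have c: "X \<alpha> \<in> carrier_mat N N" "X (\<alpha> + 1) \<in> carrier_mat N N"
    "X' \<alpha> \<in> carrier_mat N N" "X' (\<alpha> + 1) \<in> carrier_mat N N"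
    using base(1,2) \<alpha> by auto
  have Xm: "X \<beta> \<in> carrier_mat N N" if "1 \<le> \<beta>" "\<beta> \<le> m" for \<beta> using base(1) that m by simp
  have lt: "\<beta> < \<alpha>" if "\<beta> \<le> m" for \<beta> using that m by simp
  have C: "X (\<alpha> + 1) * ?P = ?P * X (\<alpha> + 1)" "X' (\<alpha> + 1) * ?P = ?P * X' (\<alpha> + 1)"
    by (rule commute_ordered_product[OF c(2) Xm comm(1)[OF _ lt]]; assumption)
      (rule commute_ordered_product[OF c(4) Xm comm(2)[OF _ lt]]; assumption)
  show ?case
  \<comment> \<open>If the earlier product \<open>?P\<close> stands left of factor \<alpha>, then
    \<open>X (\<alpha> + 1)\<close> has to pass it to meet \<open>X \<alpha>\<close>; if it stands
    right, \<open>X' (\<alpha> + 1)\<close> has to pass it instead.\<close>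
  proof (cases "m \<ge> 1 \<and> \<delta> m = NW_SE")
    case True
    then have "\<delta>' m = NW_SE" using base(4)[of m] m by simp
    then have "ordered_product N X \<delta> (\<alpha> + 1) = X (\<alpha> + 1) * (?P * X \<alpha>)"
      "ordered_product N X' \<delta>' (\<alpha> + 1) = (?P * X' \<alpha>) * X' (\<alpha> + 1)"
      using True m \<delta> P' by simp_all
    moreover have "X (\<alpha> + 1) * (?P * X \<alpha>) = ?P * (X (\<alpha> + 1) * X \<alpha>)"
      by (rule square_mat_left_commute[OF c(2) P c(1) C(1)])
    moreover have "?P * (X' \<alpha> * X' (\<alpha> + 1)) = (?P * X' \<alpha>) * X' (\<alpha> + 1)"
      using assoc_mult_mat[OF P c(3,4)] by simp
    ultimately show ?thesis using flip by simp
  next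
    case False
    then have "\<delta> m = SW_NE \<and> \<delta>' m = SW_NE \<or> m = 0"
      using base(4)[of m] m by (cases "\<delta> m") auto
    then have "ordered_product N X \<delta> (\<alpha> + 1) = X (\<alpha> + 1) * (X \<alpha> * ?P)"
      "ordered_product N X' \<delta>' (\<alpha> + 1) = (X' \<alpha> * ?P) * X' (\<alpha> + 1)"
      using c m \<delta> P' by auto
    moreover have "X (\<alpha> + 1) * (X \<alpha> * ?P) = (X (\<alpha> + 1) * X \<alpha>) * ?P"
      using assoc_mult_mat[OF c(2,1) P] by simp
    moreover have "(X' \<alpha> * X' (\<alpha> + 1)) * ?P = (X' \<alpha> * ?P) * X' (\<alpha> + 1)"
      by (rule square_mat_right_commute[OF c(4) P c(3) C(2)])
    ultimately show ?thesis using flip by simp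
  qed
next
  case (step n)
  have IH: "ordered_product N X \<delta> n = ordered_product N X' \<delta>' n"
    by (rule step.IH) (use step.prems in auto)
  have "X (Suc n) = X' (Suc n)" "\<delta> n = \<delta>' n"
    using step.prems(3)[of "Suc n"] step.prems(4)[of n] step.hyps \<alpha> by auto
  then show ?case using IH by simp
qed

section \<open>Independence of the diagonals\<close>

lemma slice_factor_up:
  assumes "1 \<le> \<alpha>" "\<kappa> \<alpha> (t + 1) = \<kappa> \<alpha> t + 1"
  shows "slice_factor r \<kappa> T d t \<alpha> = block_mat r \<alpha> 1 0
    ((if \<alpha> = r then 1 else case d t \<alpha> of
        SW_NE \<Rightarrow> T (\<alpha> + 1) (t + 1) (\<kappa> (\<alpha> + 1) (t + 1)) | NW_SE \<Rightarrow> T (\<alpha> + 1) t (\<kappa> (\<alpha> + 1) t))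
      / T \<alpha> (t + 1) (\<kappa> \<alpha> (t + 1)))
    (T \<alpha> t (\<kappa> \<alpha> t) / T \<alpha> (t + 1) (\<kappa> \<alpha> (t + 1)))"
  using assms by (simp add: slice_factor_def H_mat_eq_block_mat)

lemma slice_factor_down:
  assumes "1 \<le> \<alpha>" "\<kappa> \<alpha> (t + 1) \<noteq> \<kappa> \<alpha> t + 1"
  shows "slice_factor r \<kappa> T d t \<alpha> = block_mat r \<alpha>
    (T \<alpha> t (\<kappa> \<alpha> t) / T \<alpha> (t + 1) (\<kappa> \<alpha> (t + 1)))
    ((if \<alpha> = 1 then 1 else case d t (\<alpha> - 1) of
        SW_NE \<Rightarrow> T (\<alpha> - 1) t (\<kappa> (\<alpha> - 1) t) | NW_SE \<Rightarrow> T (\<alpha> - 1) (t + 1) (\<kappa> (\<alpha> - 1) (t + 1)))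
      / T \<alpha> (t + 1) (\<kappa> \<alpha> (t + 1))) 0 1"
  using assms by (simp add: slice_factor_def V_mat_eq_block_mat)

lemma slice_factor_block:
  assumes "1 \<le> \<alpha>"
  obtains p q s w where "slice_factor r \<kappa> T d t \<alpha> = block_mat r \<alpha> p q s w"
  using slice_factor_up[OF assms, of \<kappa> t] slice_factor_down[OF assms, of \<kappa> t] that by metis

lemma slice_factor_carrier:
  "1 \<le> \<alpha> \<Longrightarrow> slice_factor r \<kappa> T d t \<alpha> \<in> carrier_mat (r + 1) (r + 1)"
  by (metis slice_factor_block block_mat_carrier)

lemma slice_factor_commute:
  assumes "1 \<le> \<alpha>" "\<alpha> \<le> r" "1 \<le> \<beta>" "\<beta> \<le> r" "\<alpha> + 1 < \<beta> \<or> \<beta> + 1 < \<alpha>"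
  shows "slice_factor r \<kappa> T d t \<alpha> * slice_factor r \<kappa>' T d' t \<beta> =
    slice_factor r \<kappa>' T d' t \<beta> * slice_factor r \<kappa> T d t \<alpha>"
  by (rule slice_factor_block[OF assms(1), of r \<kappa> T d t],
      rule slice_factor_block[OF assms(3), of r \<kappa>' T d' t])
    (simp only: block_mat_commute[OF assms])

text \<open>Lists the heights that a factor reads: its own two, and in each adjacent row the one
  selected by the diagonal. This precision is needed when a single height changes and the diagonals
  avoid it.\<close>

lemma slice_factor_cong:
  assumes "\<kappa> \<beta> t = \<kappa>' \<beta> t" "\<kappa> \<beta> (t + 1) = \<kappa>' \<beta> (t + 1)"
    and "\<beta> \<noteq> r \<Longrightarrow> d t \<beta> = d' t \<beta>" and "\<beta> \<noteq> 1 \<Longrightarrow> d t (\<beta> - 1) = d' t (\<beta> - 1)"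
    and "\<beta> \<noteq> r \<Longrightarrow> d t \<beta> = SW_NE \<Longrightarrow> \<kappa> (\<beta> + 1) (t + 1) = \<kappa>' (\<beta> + 1) (t + 1)"
    and "\<beta> \<noteq> r \<Longrightarrow> d t \<beta> = NW_SE \<Longrightarrow> \<kappa> (\<beta> + 1) t = \<kappa>' (\<beta> + 1) t"
    and "\<beta> \<noteq> 1 \<Longrightarrow> d t (\<beta> - 1) = SW_NE \<Longrightarrow> \<kappa> (\<beta> - 1) t = \<kappa>' (\<beta> - 1) t"
    and "\<beta> \<noteq> 1 \<Longrightarrow> d t (\<beta> - 1) = NW_SE \<Longrightarrow> \<kappa> (\<beta> - 1) (t + 1) = \<kappa>' (\<beta> - 1) (t + 1)"
  shows "slice_factor r \<kappa> T d t \<beta> = slice_factor r \<kappa>' T d' t \<beta>"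
proof -
  have "(if \<beta> = r then 1 else case d t \<beta> of
        SW_NE \<Rightarrow> T (\<beta> + 1) (t + 1) (\<kappa> (\<beta> + 1) (t + 1)) | NW_SE \<Rightarrow> T (\<beta> + 1) t (\<kappa> (\<beta> + 1) t)) =
      (if \<beta> = r then 1 else case d' t \<beta> of
        SW_NE \<Rightarrow> T (\<beta> + 1) (t + 1) (\<kappa>' (\<beta> + 1) (t + 1)) | NW_SE \<Rightarrow> T (\<beta> + 1) t (\<kappa>' (\<beta> + 1) t))"
    using assms(3,5,6) by (cases "d t \<beta>") auto
  moreover have "(if \<beta> = 1 then 1 else case d t (\<beta> - 1) of
        SW_NE \<Rightarrow> T (\<beta> - 1) t (\<kappa> (\<beta> - 1) t) | NW_SE \<Rightarrow> T (\<beta> - 1) (t + 1) (\<kappa> (\<beta> - 1) (t + 1))) =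
      (if \<beta> = 1 then 1 else case d' t (\<beta> - 1) of
        SW_NE \<Rightarrow> T (\<beta> - 1) t (\<kappa>' (\<beta> - 1) t) | NW_SE \<Rightarrow> T (\<beta> - 1) (t + 1) (\<kappa>' (\<beta> - 1) (t + 1)))"
    using assms(4,7,8) by (cases "d t (\<beta> - 1)") auto
  ultimately show ?thesis unfolding slice_factor_def Let_def assms(1,2) by (simp only:)
qed

lemma slice_matrix_eq_ordered_product:
  "slice_matrix r \<kappa> T d t = ordered_product (r + 1) (slice_factor r \<kappa> T d t) (d t) r"
  unfolding slice_matrix_def by (rule slice_product_eq_ordered_product) (rule slice_factor_carrier)

lemma slice_matrix_carrier [simp]: "slice_matrix r \<kappa> T d t \<in> carrier_mat (r + 1) (r + 1)"
  unfolding slice_matrix_eq_ordered_product by (rule ordered_product_carrier) (rule slice_factor_carrier)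

lemma slice_matrix_cong:
  assumes "\<And>\<beta>. 1 \<le> \<beta> \<Longrightarrow> \<beta> \<le> r \<Longrightarrow> \<kappa> \<beta> t = \<kappa>' \<beta> t"
    and "\<And>\<beta>. 1 \<le> \<beta> \<Longrightarrow> \<beta> \<le> r \<Longrightarrow> \<kappa> \<beta> (t + 1) = \<kappa>' \<beta> (t + 1)"
    and "\<And>\<beta>. 1 \<le> \<beta> \<Longrightarrow> \<beta> < r \<Longrightarrow> d t \<beta> = d' t \<beta>"
  shows "slice_matrix r \<kappa> T d t = slice_matrix r \<kappa>' T d' t"
  unfolding slice_matrix_eq_ordered_product
proof (rule ordered_product_cong)
  fix \<beta> assume "1 \<le> \<beta>" "\<beta> \<le> r"
  then show "slice_factor r \<kappa> T d t \<beta> = slice_factor r \<kappa>' T d' t \<beta>"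
    by (intro slice_factor_cong assms) auto
qed (use assms(3) slice_factor_carrier in blast)+

text \<open>When both diagonals of a square are admissible, rows \<alpha> and \<alpha> + 1 step in
  opposite directions. If row \<alpha> rises, the new order is compensated by the new
  \<open>u\<close> and \<open>x\<close>. If it falls, neither factor reads this diagonal and the two
  commute.\<close>

lemma slice_matrix_flip:
  assumes nz: "\<And>\<beta> s. 1 \<le> \<beta> \<Longrightarrow> \<beta> \<le> r \<Longrightarrow> T \<beta> s (\<kappa> \<beta> s) \<noteq> 0"
    and step: "\<bar>\<kappa> \<alpha> (t + 1) - \<kappa> \<alpha> t\<bar> = 1"
    and \<alpha>: "1 \<le> \<alpha>" "\<alpha> < r"
    and d: "d t \<alpha> = SW_NE" "d' t \<alpha> = NW_SE" "\<And>\<beta>. 1 \<le> \<beta> \<Longrightarrow> \<beta> < r \<Longrightarrow> \<beta> \<noteq> \<alpha> \<Longrightarrow> d t \<beta> = d' t \<beta>"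
    and adm: "\<kappa> \<alpha> t = \<kappa> (\<alpha> + 1) (t + 1)" "\<kappa> \<alpha> (t + 1) = \<kappa> (\<alpha> + 1) t"
  shows "slice_matrix r \<kappa> T d t = slice_matrix r \<kappa> T d' t"
  unfolding slice_matrix_eq_ordered_product
proof (rule ordered_product_flip[where \<alpha> = \<alpha>])
  let ?X = "slice_factor r \<kappa> T d t" and ?X' = "slice_factor r \<kappa> T d' t"
  show "?X (\<alpha> + 1) * ?X \<alpha> = ?X' \<alpha> * ?X' (\<alpha> + 1)"
  proof (cases "\<kappa> \<alpha> (t + 1) = \<kappa> \<alpha> t + 1")
    case True
    then have down: "\<kappa> (\<alpha> + 1) (t + 1) \<noteq> \<kappa> (\<alpha> + 1) t + 1" using adm by simp
    have "1 \<le> \<alpha> + 1" by simp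
    note F = slice_factor_up[where \<kappa> = \<kappa> and t = t and d = d, OF \<alpha>(1) True] slice_factor_up[where \<kappa> = \<kappa> and t = t and d = d', OF \<alpha>(1) True]
      slice_factor_down[where \<kappa> = \<kappa> and t = t and d = d, OF this down] slice_factor_down[where \<kappa> = \<kappa> and t = t and d = d', OF this down]
    show ?thesis
      unfolding F
      by (rule block_mat_lower_upper_flip)
        (use \<alpha> d nz[of \<alpha> "t + 1"] nz[of "\<alpha> + 1" "t + 1"] in auto)
  next
    case False
    then have up: "\<kappa> (\<alpha> + 1) (t + 1) = \<kappa> (\<alpha> + 1) t + 1" using adm step by simp
    have "?X \<alpha> = ?X' \<alpha>"
      unfolding slice_factor_down[where \<kappa> = \<kappa> and t = t and d = d, OF \<alpha>(1) False] slice_factor_down[where \<kappa> = \<kappa> and t = t and d = d', OF \<alpha>(1) False]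
      using d(3)[of "\<alpha> - 1"] \<alpha> by auto
    moreover have "?X (\<alpha> + 1) = ?X' (\<alpha> + 1)"
      unfolding slice_factor_up[where \<kappa> = \<kappa> and t = t and d = d, OF le_add2 up]
        slice_factor_up[where \<kappa> = \<kappa> and t = t and d = d', OF le_add2 up]
      using d(3)[of "\<alpha> + 1"] \<alpha> by (cases "\<alpha> + 1 = r") auto
    moreover have "?X' (\<alpha> + 1) * ?X' \<alpha> = ?X' \<alpha> * ?X' (\<alpha> + 1)"
      using \<alpha> unfolding slice_factor_down[where \<kappa> = \<kappa> and t = t and d = d', OF \<alpha>(1) False]
        slice_factor_up[where \<kappa> = \<kappa> and t = t and d = d', OF le_add2 up]
      by (intro block_mat_upper_lower_commute) auto
    ultimately show ?thesis by simp
  qed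
  show "?X \<beta> = ?X' \<beta>" if "1 \<le> \<beta>" "\<beta> \<le> r" "\<beta> \<noteq> \<alpha>" "\<beta> \<noteq> \<alpha> + 1" for \<beta>
    by (rule slice_factor_cong) (use that in \<open>auto intro!: d(3)\<close>)
  show "?X (\<alpha> + 1) * ?X \<beta> = ?X \<beta> * ?X (\<alpha> + 1)" if "1 \<le> \<beta>" "\<beta> < \<alpha>" for \<beta>
    by (rule slice_factor_commute) (use that \<alpha> in auto)
  show "?X' (\<alpha> + 1) * ?X \<beta> = ?X \<beta> * ?X' (\<alpha> + 1)" if "1 \<le> \<beta>" "\<beta> < \<alpha>" for \<beta>
    by (rule slice_factor_commute) (use that \<alpha> in auto)
qed (use \<alpha> d slice_factor_carrier in \<open>blast | simp\<close>)+

lemma slice_matrix_diagonals_irrelevant: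
  assumes \<kappa>: "stepped_surface r \<kappa>"
    and nz: "\<And>\<beta> s. 1 \<le> \<beta> \<Longrightarrow> \<beta> \<le> r \<Longrightarrow> T \<beta> s (\<kappa> \<beta> s) \<noteq> 0"
    and d: "admissible_diagonals r \<kappa> d" and d': "admissible_diagonals r \<kappa> d'"
  shows "slice_matrix r \<kappa> T d t = slice_matrix r \<kappa> T d' t"
proof -
  \<comment> \<open>Interpolates between the two choices one row at a time; a row where they differ
    is a square with both diagonals admissible.\<close>
  define D where "D m = (\<lambda>(s::int) \<beta>. if \<beta> < m then d' s \<beta> else d s \<beta>)" for m :: nat
  have "slice_matrix r \<kappa> T (D m) t = slice_matrix r \<kappa> T d t" for m
  proof (induction m)
    case 0
    show ?case by (rule slice_matrix_cong) (auto simp: D_def)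
  next
    case (Suc m)
    have "slice_matrix r \<kappa> T (D m) t = slice_matrix r \<kappa> T (D (Suc m)) t"
    proof (cases "1 \<le> m \<and> m < r \<and> d t m \<noteq> d' t m")
      case False
      then show ?thesis by (intro slice_matrix_cong) (auto simp: D_def less_Suc_eq)
    next
      case True
      then have m: "1 \<le> m" "m < r" by auto
      have step: "\<bar>\<kappa> m (t + 1) - \<kappa> m t\<bar> = 1" using stepped_surface_column_step[OF \<kappa>] m by simp
      have "\<kappa> m t = \<kappa> (m + 1) (t + 1) \<and> \<kappa> m (t + 1) = \<kappa> (m + 1) t"
        using True d d' unfolding admissible_diagonals_def
        by (cases "d t m"; cases "d' t m") auto
      then have adm: "\<kappa> m t = \<kappa> (m + 1) (t + 1)" "\<kappa> m (t + 1) = \<kappa> (m + 1) t" by auto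
      have off: "D m t \<beta> = D (Suc m) t \<beta>" if "\<beta> \<noteq> m" for \<beta> using that by (auto simp: D_def)
      show ?thesis
      proof (cases "d t m")
        case SW_NE
        then have "d' t m = NW_SE" using True by (cases "d' t m") auto
        then show ?thesis
          using SW_NE off by (intro slice_matrix_flip[where \<kappa> = \<kappa> and t = t and \<alpha> = m and T = T, OF nz step m _ _ _ adm]) (auto simp: D_def)
      next
        case NW_SE
        then have "d' t m = SW_NE" using True by (cases "d' t m") auto
        then show ?thesis
          using NW_SE off
          by (intro slice_matrix_flip[where \<kappa> = \<kappa> and t = t and \<alpha> = m and T = T, OF nz step m _ _ _ adm, symmetric]) (auto simp: D_def)
      qed
    qed
    then show ?case using Suc by simp
  qed
  from this[of r] show ?thesis
    using slice_matrix_cong[of r \<kappa> t \<kappa> "D r" d' T] by (simp add: D_def)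
qed

section \<open>Mutations of the surface\<close>

text \<open>All lattice neighbours are one higher, so raising the vertex by 2 keeps every step equal
  to 1. The old and the raised point are the two factors on the left of the relation centred at
  height \<open>\<kappa> \<alpha> t + 1\<close>.\<close>

definition local_minimum :: "nat \<Rightarrow> (nat \<Rightarrow> int \<Rightarrow> int) \<Rightarrow> nat \<Rightarrow> int \<Rightarrow> bool" where
  "local_minimum r \<kappa> \<alpha> t \<longleftrightarrow> 1 \<le> \<alpha> \<and> \<alpha> \<le> r \<and>
     \<kappa> \<alpha> (t - 1) = \<kappa> \<alpha> t + 1 \<and> \<kappa> \<alpha> (t + 1) = \<kappa> \<alpha> t + 1 \<and>
     (1 < \<alpha> \<longrightarrow> \<kappa> (\<alpha> - 1) t = \<kappa> \<alpha> t + 1) \<and> (\<alpha> < r \<longrightarrow> \<kappa> (\<alpha> + 1) t = \<kappa> \<alpha> t + 1)"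

definition mutate :: "(nat \<Rightarrow> int \<Rightarrow> int) \<Rightarrow> nat \<Rightarrow> int \<Rightarrow> nat \<Rightarrow> int \<Rightarrow> int" where
  "mutate \<kappa> \<alpha> t = (\<lambda>\<beta> s. if \<beta> = \<alpha> \<and> s = t then \<kappa> \<alpha> t + 2 else \<kappa> \<beta> s)"

lemma stepped_surface_mutate:
  assumes \<kappa>: "stepped_surface r \<kappa>" and lm: "local_minimum r \<kappa> \<alpha> t"
  shows "stepped_surface r (mutate \<kappa> \<alpha> t)"
  unfolding stepped_surface_def
proof (intro conjI ballI allI)
  show "even (int \<beta> + j + mutate \<kappa> \<alpha> t \<beta> j)" if "\<beta> \<in> {1..r}" for \<beta> j
    using stepped_surface_parity[OF \<kappa>, of \<beta> j] that by (auto simp: mutate_def)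
  show "\<bar>mutate \<kappa> \<alpha> t (\<beta> + 1) j - mutate \<kappa> \<alpha> t \<beta> j\<bar> = 1" if "\<beta> \<in> {1..<r}" for \<beta> j
    using stepped_surface_row_step[OF \<kappa>, of \<beta> j] that lm
    by (auto simp: mutate_def local_minimum_def)
  show "\<bar>mutate \<kappa> \<alpha> t \<beta> (j + 1) - mutate \<kappa> \<alpha> t \<beta> j\<bar> = 1" if "\<beta> \<in> {1..r}" for \<beta> j
    using stepped_surface_column_step[OF \<kappa>, of \<beta> j] that lm
    by (auto simp: mutate_def local_minimum_def)
qed

text \<open>The diagonals of the four squares around \<open>(\<alpha>, t)\<close> that avoid this vertex.\<close>

definition detour_diagonals ::
  "(int \<Rightarrow> nat \<Rightarrow> diagonal) \<Rightarrow> nat \<Rightarrow> int \<Rightarrow> int \<Rightarrow> nat \<Rightarrow> diagonal" where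
  "detour_diagonals d \<alpha> t = (\<lambda>s \<beta>.
     if s = t - 1 \<and> \<beta> + 1 = \<alpha> then NW_SE
     else if s = t - 1 \<and> \<beta> = \<alpha> then SW_NE
     else if s = t \<and> \<beta> + 1 = \<alpha> then SW_NE
     else if s = t \<and> \<beta> = \<alpha> then NW_SE
     else d s \<beta>)"

text \<open>The four new diagonals join neighbours of (\<alpha>, t), which share the height
  \<open>\<kappa> \<alpha> t + 1\<close> and are not moved by the mutation. One choice thus serves
  both surfaces.\<close>

lemma admissible_detour_diagonals:
  assumes lm: "local_minimum r \<kappa> \<alpha> t" and d: "admissible_diagonals r \<kappa> d"
    and \<mu>: "\<mu> = \<kappa> \<or> \<mu> = mutate \<kappa> \<alpha> t"
  shows "admissible_diagonals r \<mu> (detour_diagonals d \<alpha> t)"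
  unfolding admissible_diagonals_def
proof (intro allI ballI)
  fix s \<beta> assume \<beta>: "\<beta> \<in> {1..<r}"
  have off: "\<mu> \<beta>' s' = \<kappa> \<beta>' s'" if "\<beta>' \<noteq> \<alpha> \<or> s' \<noteq> t" for \<beta>' s'
    using \<mu> that by (auto simp: mutate_def)
  consider (1) "s = t - 1" "\<alpha> = \<beta> + 1" | (2) "s = t - 1" "\<alpha> = \<beta>" | (3) "s = t" "\<alpha> = \<beta> + 1"
    | (4) "s = t" "\<alpha> = \<beta>" | (5) "s \<noteq> t \<and> s + 1 \<noteq> t \<or> \<beta> \<noteq> \<alpha> \<and> \<beta> + 1 \<noteq> \<alpha>"
    by force
  then show "(detour_diagonals d \<alpha> t s \<beta> = SW_NE \<longrightarrow> \<mu> \<beta> s = \<mu> (\<beta> + 1) (s + 1)) \<and>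
      (detour_diagonals d \<alpha> t s \<beta> = NW_SE \<longrightarrow> \<mu> \<beta> (s + 1) = \<mu> (\<beta> + 1) s)"
  proof cases
    case 5
    then have "detour_diagonals d \<alpha> t s \<beta> = d s \<beta>" by (auto simp: detour_diagonals_def)
    moreover have "\<mu> \<beta> s = \<kappa> \<beta> s" "\<mu> (\<beta> + 1) (s + 1) = \<kappa> (\<beta> + 1) (s + 1)"
      "\<mu> \<beta> (s + 1) = \<kappa> \<beta> (s + 1)" "\<mu> (\<beta> + 1) s = \<kappa> (\<beta> + 1) s"
      using 5 by (auto intro!: off)
    ultimately show ?thesis using d \<beta> unfolding admissible_diagonals_def by metis
  qed (use lm \<beta> in \<open>simp_all add: detour_diagonals_def local_minimum_def off\<close>)
qed

lemma slice_matrix_extract_left: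
  assumes "1 \<le> \<alpha>" "\<alpha> \<le> r" "\<alpha> > 1 \<Longrightarrow> d t (\<alpha> - 1) = SW_NE" "\<alpha> < r \<Longrightarrow> d t \<alpha> = NW_SE"
  shows "slice_matrix r \<kappa> T d t = slice_factor r \<kappa> T d t \<alpha> *
    ordered_product (r + 1) ((slice_factor r \<kappa> T d t)(\<alpha> := 1\<^sub>m (r + 1))) (d t) r"
  unfolding slice_matrix_eq_ordered_product
proof (rule ordered_product_extract_left)
  show "slice_factor r \<kappa> T d t \<beta> * slice_factor r \<kappa> T d t \<alpha> = slice_factor r \<kappa> T d t \<alpha> * slice_factor r \<kappa> T d t \<beta>"
    if "\<alpha> + 1 < \<beta>" "\<beta> \<le> r" for \<beta>
    by (rule slice_factor_commute) (use that assms in auto)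
qed (use assms slice_factor_carrier in blast)+

lemma slice_matrix_extract_right:
  assumes "1 \<le> \<alpha>" "\<alpha> \<le> r" "\<alpha> > 1 \<Longrightarrow> d t (\<alpha> - 1) = NW_SE" "\<alpha> < r \<Longrightarrow> d t \<alpha> = SW_NE"
  shows "slice_matrix r \<kappa> T d t =
    ordered_product (r + 1) ((slice_factor r \<kappa> T d t)(\<alpha> := 1\<^sub>m (r + 1))) (d t) r * slice_factor r \<kappa> T d t \<alpha>"
  unfolding slice_matrix_eq_ordered_product
proof (rule ordered_product_extract_right)
  show "slice_factor r \<kappa> T d t \<beta> * slice_factor r \<kappa> T d t \<alpha> = slice_factor r \<kappa> T d t \<alpha> * slice_factor r \<kappa> T d t \<beta>"
    if "\<alpha> + 1 < \<beta>" "\<beta> \<le> r" for \<beta>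
    by (rule slice_factor_commute) (use that assms in auto)
qed (use assms slice_factor_carrier in blast)+

text \<open>In the 2 x 2 blocks the off-diagonal entries of V H and H V agree outright. The diagonal
  entries agree by the relation b' b = c a + u x, divided by b c and by b' c respectively.\<close>

lemma slice_factor_pair_mutate:
  assumes T: "T_system r T" and \<kappa>: "stepped_surface r \<kappa>" and lm: "local_minimum r \<kappa> \<alpha> t"
    and nz: "\<And>\<beta> s k. 1 \<le> \<beta> \<Longrightarrow> \<beta> \<le> r \<Longrightarrow> even (int \<beta> + s + k) \<Longrightarrow> T \<beta> s k \<noteq> 0"
    and d_def: "d = detour_diagonals d\<^sub>0 \<alpha> t"
  shows "slice_factor r \<kappa> T d (t - 1) \<alpha> * slice_factor r \<kappa> T d t \<alpha> =
    slice_factor r (mutate \<kappa> \<alpha> t) T d (t - 1) \<alpha> * slice_factor r (mutate \<kappa> \<alpha> t) T d t \<alpha>"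
proof -
  let ?\<mu> = "mutate \<kappa> \<alpha> t"
  define k where "k = \<kappa> \<alpha> t"
  have \<alpha>: "1 \<le> \<alpha>" "\<alpha> \<le> r" using lm by (auto simp: local_minimum_def)
  have ev: "even (int \<alpha> + t + k)" using stepped_surface_parity[OF \<kappa> \<alpha>] k_def by simp
  have nb: "\<kappa> \<alpha> (t - 1) = k + 1" "\<kappa> \<alpha> (t + 1) = k + 1"
      "\<alpha> \<noteq> 1 \<Longrightarrow> \<kappa> (\<alpha> - 1) t = k + 1" "\<alpha> \<noteq> r \<Longrightarrow> \<kappa> (\<alpha> + 1) t = k + 1"
    using lm by (auto simp: local_minimum_def k_def)
  have \<mu>: "?\<mu> \<alpha> (t - 1) = k + 1" "?\<mu> \<alpha> (t + 1) = k + 1" "?\<mu> \<alpha> t = k + 2"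
      "\<alpha> \<noteq> 1 \<Longrightarrow> ?\<mu> (\<alpha> - 1) t = k + 1" "\<alpha> \<noteq> r \<Longrightarrow> ?\<mu> (\<alpha> + 1) t = k + 1"
    using nb by (auto simp: mutate_def k_def)
  have d: "\<alpha> \<noteq> 1 \<Longrightarrow> d (t - 1) (\<alpha> - 1) = NW_SE" "d (t - 1) \<alpha> = SW_NE"
      "\<alpha> \<noteq> 1 \<Longrightarrow> d t (\<alpha> - 1) = SW_NE" "d t \<alpha> = NW_SE"
    using \<alpha> by (auto simp: d_def detour_diagonals_def)
  define a b b' c x u where "a = T \<alpha> (t - 1) (k + 1)" and "b = T \<alpha> t k" and "b' = T \<alpha> t (k + 2)"
    and "c = T \<alpha> (t + 1) (k + 1)" and "x = T (\<alpha> - 1) t (k + 1)" and "u = T (\<alpha> + 1) t (k + 1)"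
  have nonzero: "b \<noteq> 0" "b' \<noteq> 0" "c \<noteq> 0"
    unfolding b_def b'_def c_def by (rule nz[OF \<alpha>]; use ev in presburger)+
  have "T \<alpha> t (k + 1 + 1) * T \<alpha> t (k + 1 - 1) =
      T \<alpha> (t + 1) (k + 1) * T \<alpha> (t - 1) (k + 1) + T (\<alpha> + 1) t (k + 1) * T (\<alpha> - 1) t (k + 1)"
    by (rule T_system_relation[OF T \<alpha>]) (use ev in simp)
  then have rel: "b' * b = c * a + u * x"
    by (simp add: a_def b_def b'_def c_def x_def u_def add.commute)
  then have a_eq: "a = (b' * b - u * x) / c" using nonzero by (simp add: field_simps)
  \<comment> \<open>In the extreme rows the factors contain a literal 1; the values of
    \<open>T\<close> in rows 0 and r + 1 let \<open>x\<close> and \<open>u\<close> cover these cases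
    too.\<close>
  have x1: "x = 1" if "\<alpha> = 1"
  proof -
    have "even (t + (k + 1))" using ev that by presburger
    then have "T 0 t (k + 1) = 1" using T unfolding T_system_def by blast
    then show ?thesis using that by (simp add: x_def)
  qed
  have u1: "u = 1" if "\<alpha> = r"
  proof -
    have "even (int (r + 1) + t + (k + 1))" using ev that by presburger
    then have "T (r + 1) t (k + 1) = 1" using T unfolding T_system_def by blast
    then show ?thesis using that by (simp add: u_def)
  qed
  have "slice_factor r \<kappa> T d (t - 1) \<alpha> = block_mat r \<alpha> (a / b) (x / b) 0 1"
    using slice_factor_down[of \<alpha> \<kappa> "t - 1" r T d] \<alpha> nb d x1
    by (cases "\<alpha> = 1") (auto simp: a_def b_def x_def k_def)
  moreover have "slice_factor r \<kappa> T d t \<alpha> = block_mat r \<alpha> 1 0 (u / c) (b / c)"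
    using slice_factor_up[of \<alpha> \<kappa> t r T d] \<alpha> nb d u1
    by (cases "\<alpha> = r") (auto simp: b_def c_def u_def k_def)
  moreover have "slice_factor r ?\<mu> T d (t - 1) \<alpha> = block_mat r \<alpha> 1 0 (u / b') (a / b')"
    using slice_factor_up[of \<alpha> ?\<mu> "t - 1" r T d] \<alpha> \<mu> d u1
    by (cases "\<alpha> = r") (auto simp: a_def b'_def u_def add.commute[of 2 k])
  moreover have "slice_factor r ?\<mu> T d t \<alpha> = block_mat r \<alpha> (b' / c) (x / c) 0 1"
    using slice_factor_down[of \<alpha> ?\<mu> t r T d] \<alpha> \<mu> d x1
    by (cases "\<alpha> = 1") (auto simp: b'_def c_def x_def add.commute[of 2 k])
  moreover have "a / b * 1 + x / b * (u / c) = 1 * (b' / c) + 0 * 0"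
    unfolding a_eq using nonzero by (simp add: field_simps)
  moreover have "0 * 0 + 1 * (b / c) = u / b' * (x / c) + a / b' * 1"
    unfolding a_eq using nonzero by (simp add: field_simps)
  moreover have "a / b * 0 + x / b * (b / c) = 1 * (x / c) + 0 * 1"
    using nonzero by simp
  moreover have "0 * 1 + 1 * (u / c) = u / b' * (b' / c) + a / b' * 0"
    using nonzero by simp
  ultimately show ?thesis by (simp only: block_mat_mult_same[OF \<alpha>])
qed

lemma slice_matrix_pair_mutate:
  assumes T: "T_system r T" and \<kappa>: "stepped_surface r \<kappa>" and lm: "local_minimum r \<kappa> \<alpha> t"
    and nz: "\<And>\<beta> s k. 1 \<le> \<beta> \<Longrightarrow> \<beta> \<le> r \<Longrightarrow> even (int \<beta> + s + k) \<Longrightarrow> T \<beta> s k \<noteq> 0"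
    and d_def: "d = detour_diagonals d\<^sub>0 \<alpha> t"
  shows "slice_matrix r \<kappa> T d (t - 1) * slice_matrix r \<kappa> T d t =
    slice_matrix r (mutate \<kappa> \<alpha> t) T d (t - 1) * slice_matrix r (mutate \<kappa> \<alpha> t) T d t"
proof -
  let ?\<mu> = "mutate \<kappa> \<alpha> t"
  have \<alpha>: "1 \<le> \<alpha>" "\<alpha> \<le> r" using lm by (auto simp: local_minimum_def)
  have d: "\<alpha> > 1 \<Longrightarrow> d (t - 1) (\<alpha> - 1) = NW_SE" "d (t - 1) \<alpha> = SW_NE"
      "\<alpha> > 1 \<Longrightarrow> d t (\<alpha> - 1) = SW_NE" "d t \<alpha> = NW_SE"
    using \<alpha> by (auto simp: d_def detour_diagonals_def)
  \<comment> \<open>What remains of the two slices once the factors of row \<alpha> are taken out at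
    the junction. These remainders do not read the height at (\<alpha>, t), hence coincide for
    \<kappa> and its mutation.\<close>
  let ?L = "\<lambda>\<kappa>. ordered_product (r + 1) ((slice_factor r \<kappa> T d (t - 1))(\<alpha> := 1\<^sub>m (r + 1))) (d (t - 1)) r"
  let ?R = "\<lambda>\<kappa>. ordered_product (r + 1) ((slice_factor r \<kappa> T d t)(\<alpha> := 1\<^sub>m (r + 1))) (d t) r"
  let ?X = "\<lambda>\<kappa> s. slice_factor r \<kappa> T d s \<alpha>"
  have car: "?L \<kappa>' \<in> carrier_mat (r + 1) (r + 1)" "?R \<kappa>' \<in> carrier_mat (r + 1) (r + 1)" for \<kappa>'
    by (rule ordered_product_carrier; simp add: slice_factor_carrier del: One_nat_def)+
  have carX: "?X \<kappa>' s \<in> carrier_mat (r + 1) (r + 1)" for \<kappa>' s by (rule slice_factor_carrier[OF \<alpha>(1)])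
  have L: "?L \<kappa> = ?L ?\<mu>"
  proof (rule ordered_product_cong)
    fix \<beta> assume \<beta>: "1 \<le> \<beta>" "\<beta> \<le> r"
    show "((slice_factor r \<kappa> T d (t - 1))(\<alpha> := 1\<^sub>m (r + 1))) \<beta> =
        ((slice_factor r ?\<mu> T d (t - 1))(\<alpha> := 1\<^sub>m (r + 1))) \<beta>"
    proof (cases "\<beta> = \<alpha>")
      case False
      then have "slice_factor r \<kappa> T d (t - 1) \<beta> = slice_factor r ?\<mu> T d (t - 1) \<beta>"
        using \<beta> by (intro slice_factor_cong) (auto simp: mutate_def d_def detour_diagonals_def)
      then show ?thesis using False by simp
    qed simp
  qed (simp_all add: slice_factor_carrier del: One_nat_def)
  have R: "?R \<kappa> = ?R ?\<mu>"
  proof (rule ordered_product_cong)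
    fix \<beta> assume \<beta>: "1 \<le> \<beta>" "\<beta> \<le> r"
    show "((slice_factor r \<kappa> T d t)(\<alpha> := 1\<^sub>m (r + 1))) \<beta> = ((slice_factor r ?\<mu> T d t)(\<alpha> := 1\<^sub>m (r + 1))) \<beta>"
    proof (cases "\<beta> = \<alpha>")
      case False
      then have "slice_factor r \<kappa> T d t \<beta> = slice_factor r ?\<mu> T d t \<beta>"
        using \<beta> by (intro slice_factor_cong) (auto simp: mutate_def d_def detour_diagonals_def)
      then show ?thesis using False by simp
    qed simp
  qed (simp_all add: slice_factor_carrier del: One_nat_def)
  have split: "slice_matrix r \<kappa>' T d (t - 1) * slice_matrix r \<kappa>' T d t =
      ?L \<kappa>' * (?X \<kappa>' (t - 1) * ?X \<kappa>' t) * ?R \<kappa>'" for \<kappa>'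
  proof -
    have "slice_matrix r \<kappa>' T d (t - 1) * slice_matrix r \<kappa>' T d t =
        (?L \<kappa>' * ?X \<kappa>' (t - 1)) * (?X \<kappa>' t * ?R \<kappa>')"
      using slice_matrix_extract_right[of \<alpha> r d "t - 1" \<kappa>' T] slice_matrix_extract_left[of \<alpha> r d t \<kappa>' T] \<alpha> d
      by (simp only:)
    also have "\<dots> = (?L \<kappa>' * ?X \<kappa>' (t - 1)) * ?X \<kappa>' t * ?R \<kappa>'"
      by (rule assoc_mult_mat[symmetric, OF mult_carrier_mat[OF car(1) carX] carX car(2)])
    also have "(?L \<kappa>' * ?X \<kappa>' (t - 1)) * ?X \<kappa>' t = ?L \<kappa>' * (?X \<kappa>' (t - 1) * ?X \<kappa>' t)"
      by (rule assoc_mult_mat[OF car(1) carX carX])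
    finally show ?thesis .
  qed
  have "?X \<kappa> (t - 1) * ?X \<kappa> t = ?X ?\<mu> (t - 1) * ?X ?\<mu> t"
    by (rule slice_factor_pair_mutate[OF T \<kappa> lm nz d_def])
  then show ?thesis unfolding split L R by simp
qed

section \<open>Products of consecutive slices\<close>

text \<open>The slices with A \<le> t < B, in the form in which the theorem writes their
  product.\<close>

definition slice_chain ::
  "nat \<Rightarrow> (nat \<Rightarrow> int \<Rightarrow> int) \<Rightarrow> (nat \<Rightarrow> int \<Rightarrow> int \<Rightarrow> 'a::field) \<Rightarrow> (int \<Rightarrow> nat \<Rightarrow> diagonal)
    \<Rightarrow> int \<Rightarrow> int \<Rightarrow> 'a mat" where
  "slice_chain r \<kappa> T d A B = foldr (*) (map (slice_matrix r \<kappa> T d) [A..B - 1]) (1\<^sub>m (r + 1))"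

lemma slice_chain_refl [simp]: "slice_chain r \<kappa> T d A A = 1\<^sub>m (r + 1)"
  by (simp add: slice_chain_def)

lemma slice_chain_step:
  "A < B \<Longrightarrow> slice_chain r \<kappa> T d A B = slice_matrix r \<kappa> T d A * slice_chain r \<kappa> T d (A + 1) B"
  by (simp add: slice_chain_def upto_rec1)

lemma slice_chain_carrier: "slice_chain r \<kappa> T d A B \<in> carrier_mat (r + 1) (r + 1)"
proof -
  have "foldr (*) (map (slice_matrix r \<kappa> T d) ts) (1\<^sub>m (r + 1)) \<in> carrier_mat (r + 1) (r + 1)" for ts
  proof (induction ts)
    case (Cons t ts)
    then show ?case using mult_carrier_mat[OF slice_matrix_carrier Cons] by simp
  qed simp
  then show ?thesis by (simp add: slice_chain_def)
qed

lemma slice_chain_append: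
  assumes "A \<le> B" "B \<le> C"
  shows "slice_chain r \<kappa> T d A C = slice_chain r \<kappa> T d A B * slice_chain r \<kappa> T d B C"
  using assms
proof (induction "nat (B - A)" arbitrary: A)
  case 0
  then have "A = B" by simp
  then show ?case by (simp only: slice_chain_refl left_mult_one_mat[OF slice_chain_carrier])
next
  case (Suc n)
  then have "A < B" by linarith
  have "slice_chain r \<kappa> T d (A + 1) C = slice_chain r \<kappa> T d (A + 1) B * slice_chain r \<kappa> T d B C"
    by (rule Suc(1)) (use Suc.hyps(2) \<open>A < B\<close> Suc.prems in auto)
  then show ?case
    using \<open>A < B\<close> Suc.prems
    by (simp add: slice_chain_step assoc_mult_mat[OF slice_matrix_carrier slice_chain_carrier slice_chain_carrier])
qed

lemma slice_chain_cong:
  assumes "\<And>t. A \<le> t \<Longrightarrow> t < B \<Longrightarrow> slice_matrix r \<kappa> T d t = slice_matrix r \<kappa>' T d' t"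
  shows "slice_chain r \<kappa> T d A B = slice_chain r \<kappa>' T d' A B"
proof -
  have "map (slice_matrix r \<kappa> T d) [A..B - 1] = map (slice_matrix r \<kappa>' T d') [A..B - 1]"
    using assms by (intro map_cong) auto
  then show ?thesis by (simp only: slice_chain_def)
qed

text \<open>Only the slices t - 1 and t read column t, and A < t < B puts both into the chain. The
  diagonals are exchanged on the unchanged surface first; then the surface is mutated with the
  diagonals fixed.\<close>

lemma slice_chain_mutate:
  assumes T: "T_system r T" and \<kappa>: "stepped_surface r \<kappa>" and lm: "local_minimum r \<kappa> \<alpha> t"
    and nz: "\<And>\<beta> s k. 1 \<le> \<beta> \<Longrightarrow> \<beta> \<le> r \<Longrightarrow> even (int \<beta> + s + k) \<Longrightarrow> T \<beta> s k \<noteq> 0"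
    and d: "admissible_diagonals r \<kappa> d"
    and t: "A < t" "t < B"
  shows "slice_chain r \<kappa> T d A B = slice_chain r (mutate \<kappa> \<alpha> t) T (detour_diagonals d \<alpha> t) A B"
proof -
  let ?d = "detour_diagonals d \<alpha> t" and ?\<mu> = "mutate \<kappa> \<alpha> t"
  let ?F = "slice_chain r \<kappa> T ?d" and ?G = "slice_chain r ?\<mu> T ?d"
  have nz': "T \<beta> s (\<kappa> \<beta> s) \<noteq> 0" if "1 \<le> \<beta>" "\<beta> \<le> r" for \<beta> s
    by (rule nz[OF that stepped_surface_parity[OF \<kappa> that]])
  have "slice_chain r \<kappa> T d A B = ?F A B"
    by (intro slice_chain_cong slice_matrix_diagonals_irrelevant[where r = r and \<kappa> = \<kappa> and T = T] \<kappa> nz' d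
        admissible_detour_diagonals[OF lm d] disjI1 refl)
  also have "?F A B = ?G A B"
  proof -
    have split: "slice_chain r \<kappa>' T ?d A B = slice_chain r \<kappa>' T ?d A (t - 1) *
        (slice_matrix r \<kappa>' T ?d (t - 1) * slice_matrix r \<kappa>' T ?d t * slice_chain r \<kappa>' T ?d (t + 1) B)" for \<kappa>'
      using slice_chain_append[of A "t - 1" B r \<kappa>' T ?d] slice_chain_step[of "t - 1" B r \<kappa>' T ?d]
        slice_chain_step[of t B r \<kappa>' T ?d] t
      by (simp add: assoc_mult_mat[OF slice_matrix_carrier slice_matrix_carrier slice_chain_carrier])
    have same: "slice_matrix r \<kappa> T ?d s = slice_matrix r ?\<mu> T ?d s" if "s \<noteq> t" "s + 1 \<noteq> t" for s
      by (rule slice_matrix_cong) (use that in \<open>auto simp: mutate_def\<close>)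
    have "?F A (t - 1) = ?G A (t - 1)" "?F (t + 1) B = ?G (t + 1) B"
      by (rule slice_chain_cong, rule same; simp)+
    moreover have "slice_matrix r \<kappa> T ?d (t - 1) * slice_matrix r \<kappa> T ?d t =
        slice_matrix r ?\<mu> T ?d (t - 1) * slice_matrix r ?\<mu> T ?d t"
      by (rule slice_matrix_pair_mutate[OF T \<kappa> lm nz refl])
    ultimately show ?thesis unfolding split[of \<kappa>] split[of ?\<mu>] by simp
  qed
  finally show ?thesis .
qed

section \<open>Eigenvectors at the first index and the (1,1) entry\<close>

definition first_row :: "nat \<Rightarrow> 'a::field \<Rightarrow> 'a mat \<Rightarrow> bool" where
  "first_row N c A \<longleftrightarrow> A \<in> carrier_mat N N \<and> (\<forall>j<N. A $$ (0, j) = (if j = 0 then c else 0))"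

definition first_column :: "nat \<Rightarrow> 'a::field \<Rightarrow> 'a mat \<Rightarrow> bool" where
  "first_column N c A \<longleftrightarrow> A \<in> carrier_mat N N \<and> (\<forall>i<N. A $$ (i, 0) = (if i = 0 then c else 0))"

text \<open>\<open>first_row N c A\<close> says that the first unit row vector is a left eigenvector
  of \<open>A\<close> with eigenvalue \<open>c\<close>; \<open>first_column\<close> is the analogue
  for right eigenvectors. Eigenvalues multiply along a chain.\<close>

lemma first_row_mult_index:
  assumes "first_row N c A" "B \<in> carrier_mat N N" "j < N"
  shows "(A * B) $$ (0, j) = c * B $$ (0, j)"
proof -
  have "(A * B) $$ (0, j) = (\<Sum>l\<in>{0..<N}. A $$ (0, l) * B $$ (l, j))"
    using assms by (auto simp: first_row_def scalar_prod_def)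
  also have "\<dots> = (\<Sum>l\<in>{0}. A $$ (0, l) * B $$ (l, j))"
    using assms by (intro sum.mono_neutral_right) (auto simp: first_row_def)
  finally show ?thesis using assms by (simp add: first_row_def)
qed

lemma first_column_mult_index:
  assumes "A \<in> carrier_mat N N" "first_column N c B" "i < N"
  shows "(A * B) $$ (i, 0) = A $$ (i, 0) * c"
proof -
  have "(A * B) $$ (i, 0) = (\<Sum>l\<in>{0..<N}. A $$ (i, l) * B $$ (l, 0))"
    using assms by (auto simp: first_column_def scalar_prod_def)
  also have "\<dots> = (\<Sum>l\<in>{0}. A $$ (i, l) * B $$ (l, 0))"
    using assms by (intro sum.mono_neutral_right) (auto simp: first_column_def)
  finally show ?thesis using assms by (simp add: first_column_def)
qed

lemma first_row_mult:
  assumes "first_row N c A" "first_row N c' B"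
  shows "first_row N (c * c') (A * B)"
  using assms first_row_mult_index[OF assms(1)] unfolding first_row_def
  by (auto intro: mult_carrier_mat)

lemma first_column_mult:
  assumes "first_column N c A" "first_column N c' B"
  shows "first_column N (c * c') (A * B)"
  using assms first_column_mult_index[OF _ assms(2)] unfolding first_column_def
  by (auto intro: mult_carrier_mat)

lemma first_row_one: "first_row N 1 (1\<^sub>m N)"
  by (auto simp: first_row_def)

lemma first_column_one: "first_column N 1 (1\<^sub>m N)"
  by (auto simp: first_column_def)

lemma first_row_block_mat: "first_row (r + 1) 1 (block_mat r 1 1 0 s w)"
  unfolding first_row_def by (intro conjI block_mat_carrier) (simp add: block_mat_index)

lemma first_column_block_mat: "first_column (r + 1) p (block_mat r 1 p q 0 1)"
  unfolding first_column_def by (intro conjI block_mat_carrier) (simp add: block_mat_index)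

text \<open>For \<alpha> > 1 the block avoids index 0, so only the factor of row 1 can affect the
  eigenvalue.\<close>

lemma block_mat_fixes_first:
  assumes "1 < \<alpha>"
  shows "first_row (r + 1) 1 (block_mat r \<alpha> p q s w)" "first_column (r + 1) 1 (block_mat r \<alpha> p q s w)"
  unfolding first_row_def first_column_def
  by (intro conjI block_mat_carrier; use assms in \<open>auto simp: block_mat_index\<close>)+

lemma ordered_product_first_row:
  assumes "\<And>\<beta>. 1 \<le> \<beta> \<Longrightarrow> \<beta> \<le> n \<Longrightarrow> first_row N 1 (X \<beta>)"
  shows "first_row N 1 (ordered_product N X \<delta> n)"
  using assms
proof (induction n)
  case (Suc n)
  then have "first_row N 1 (ordered_product N X \<delta> n)" "first_row N 1 (X (Suc n))" by auto
  then have "first_row N 1 (X (Suc n) * ordered_product N X \<delta> n)"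
    "first_row N 1 (ordered_product N X \<delta> n * X (Suc n))"
    using first_row_mult by fastforce+
  then show ?case by simp
qed (simp add: first_row_one)

lemma ordered_product_first_column:
  assumes "\<And>\<beta>. 1 < \<beta> \<Longrightarrow> \<beta> \<le> n \<Longrightarrow> first_column N 1 (X \<beta>)" "first_column N c (X 1)" "1 \<le> n"
  shows "first_column N c (ordered_product N X \<delta> n)"
  using assms
proof (induction n)
  case (Suc n)
  show ?case
  proof (cases "n = 0")
    case True
    then show ?thesis
      using first_column_mult[OF Suc.prems(2) first_column_one] first_column_mult[OF first_column_one Suc.prems(2)]
      by simp
  next
    case False
    then have "first_column N c (ordered_product N X \<delta> n)" "first_column N 1 (X (Suc n))"
      using Suc by auto
    then have "first_column N c (X (Suc n) * ordered_product N X \<delta> n)"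
      "first_column N c (ordered_product N X \<delta> n * X (Suc n))"
      using first_column_mult by fastforce+
    then show ?thesis by simp
  qed
qed simp

lemma slice_matrix_first_row_up:
  assumes "\<kappa> 1 (t + 1) = \<kappa> 1 t + 1"
  shows "first_row (r + 1) 1 (slice_matrix r \<kappa> T d t)"
  unfolding slice_matrix_eq_ordered_product
proof (rule ordered_product_first_row)
  fix \<beta> assume \<beta>: "1 \<le> \<beta>" "\<beta> \<le> r"
  show "first_row (r + 1) 1 (slice_factor r \<kappa> T d t \<beta>)"
  proof (cases "\<beta> = 1")
    case True
    show ?thesis
      unfolding True slice_factor_up[where \<alpha> = 1 and \<kappa> = \<kappa> and t = t, OF order_refl assms]
      by (rule first_row_block_mat)
  next
    case False
    then have "1 < \<beta>" using \<beta> by simp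
    then show ?thesis using slice_factor_block[OF \<beta>(1)] block_mat_fixes_first(1) by metis
  qed
qed

lemma slice_matrix_first_column_down:
  assumes "1 \<le> r" "\<kappa> 1 (t + 1) \<noteq> \<kappa> 1 t + 1"
  shows "first_column (r + 1) (T 1 t (\<kappa> 1 t) / T 1 (t + 1) (\<kappa> 1 (t + 1))) (slice_matrix r \<kappa> T d t)"
  unfolding slice_matrix_eq_ordered_product
proof (rule ordered_product_first_column)
  fix \<beta> :: nat assume \<beta>: "1 < \<beta>" "\<beta> \<le> r"
  then show "first_column (r + 1) 1 (slice_factor r \<kappa> T d t \<beta>)"
    using slice_factor_block[of \<beta>] block_mat_fixes_first(2)[OF \<beta>(1)] by (metis less_imp_le)
next
  show "first_column (r + 1) (T 1 t (\<kappa> 1 t) / T 1 (t + 1) (\<kappa> 1 (t + 1))) (slice_factor r \<kappa> T d t 1)"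
    unfolding slice_factor_down[where \<alpha> = 1 and \<kappa> = \<kappa> and t = t, OF order_refl assms(2)]
    by (rule first_column_block_mat)
qed (use assms in auto)

lemma slice_chain_first_row_up:
  assumes "A \<le> B" "\<And>t. A \<le> t \<Longrightarrow> t < B \<Longrightarrow> \<kappa> 1 (t + 1) = \<kappa> 1 t + 1"
  shows "first_row (r + 1) 1 (slice_chain r \<kappa> T d A B)"
  using assms
proof (induction "nat (B - A)" arbitrary: A)
  case 0
  then show ?case using first_row_one[of "r + 1"] by (simp add: slice_chain_def)
next
  case (Suc n)
  then have "A < B" by linarith
  have "first_row (r + 1) 1 (slice_chain r \<kappa> T d (A + 1) B)"
    by (rule Suc(1)) (use Suc.hyps(2) \<open>A < B\<close> Suc.prems in auto)
  moreover have "first_row (r + 1) 1 (slice_matrix r \<kappa> T d A)"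
    by (rule slice_matrix_first_row_up) (use Suc.prems(2) \<open>A < B\<close> in auto)
  ultimately have "first_row (r + 1) (1 * 1) (slice_chain r \<kappa> T d A B)"
    unfolding slice_chain_step[OF \<open>A < B\<close>] by (intro first_row_mult)
  then show ?case by simp
qed

lemma slice_chain_first_column_down:
  assumes "1 \<le> r" "A \<le> B" "\<And>t. A \<le> t \<Longrightarrow> t < B \<Longrightarrow> \<kappa> 1 (t + 1) \<noteq> \<kappa> 1 t + 1"
    and nz: "\<And>t. T 1 t (\<kappa> 1 t) \<noteq> 0"
  shows "first_column (r + 1) (T 1 A (\<kappa> 1 A) / T 1 B (\<kappa> 1 B)) (slice_chain r \<kappa> T d A B)"
  using assms(2,3)
proof (induction "nat (B - A)" arbitrary: A)
  case 0
  then have "A = B" by simp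
  then show ?case using first_column_one[of "r + 1"] nz by simp
next
  case (Suc n)
  then have "A < B" by linarith
  have "first_column (r + 1) (T 1 (A + 1) (\<kappa> 1 (A + 1)) / T 1 B (\<kappa> 1 B)) (slice_chain r \<kappa> T d (A + 1) B)"
    by (rule Suc(1)) (use Suc.hyps(2) \<open>A < B\<close> Suc.prems in auto)
  moreover have "first_column (r + 1) (T 1 A (\<kappa> 1 A) / T 1 (A + 1) (\<kappa> 1 (A + 1))) (slice_matrix r \<kappa> T d A)"
    by (rule slice_matrix_first_column_down) (use assms(1) Suc.prems(2) \<open>A < B\<close> in auto)
  ultimately have "first_column (r + 1)
      (T 1 A (\<kappa> 1 A) / T 1 (A + 1) (\<kappa> 1 (A + 1)) * (T 1 (A + 1) (\<kappa> 1 (A + 1)) / T 1 B (\<kappa> 1 B)))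
      (slice_chain r \<kappa> T d A B)"
    unfolding slice_chain_step[OF \<open>A < B\<close>] by (rule first_column_mult[rotated])
  then show ?case using nz[of "A + 1"] by simp
qed

text \<open>The rising slices on the left have eigenvalue 1, and the falling ones on the right
  contribute a telescoping quotient that the prefactor absorbs. Applied twice: to a surface with the
  tent as row 1, where p = q is the apex, and to the cut boundary, to discard what lies outside
  \<open>j\<^sub>0\<close> and \<open>j\<^sub>1\<close>.\<close>

lemma slice_chain_entry_trim:
  assumes "1 \<le> r" and le: "A \<le> p" "p \<le> q" "q \<le> B"
    and up: "\<And>t. A \<le> t \<Longrightarrow> t < p \<Longrightarrow> \<kappa> 1 (t + 1) = \<kappa> 1 t + 1"
    and down: "\<And>t. q \<le> t \<Longrightarrow> t < B \<Longrightarrow> \<kappa> 1 (t + 1) \<noteq> \<kappa> 1 t + 1"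
    and nz: "\<And>t. T 1 t (\<kappa> 1 t) \<noteq> 0"
  shows "T 1 B (\<kappa> 1 B) * slice_chain r \<kappa> T d A B $$ (0, 0) =
    T 1 q (\<kappa> 1 q) * slice_chain r \<kappa> T d p q $$ (0, 0)"
proof -
  let ?F = "slice_chain r \<kappa> T d"
  have split: "?F A B = ?F A p * (?F p q * ?F q B)"
    using slice_chain_append[of A p B r \<kappa> T d] slice_chain_append[of p q B r \<kappa> T d] le by simp
  have row: "first_row (r + 1) 1 (?F A p)" by (rule slice_chain_first_row_up) (use le up in auto)
  have "?F A B $$ (0, 0) = 1 * (?F p q * ?F q B) $$ (0, 0)"
    unfolding split
    by (rule first_row_mult_index[OF row mult_carrier_mat[OF slice_chain_carrier slice_chain_carrier]]) simp
  also have "(?F p q * ?F q B) $$ (0, 0) = ?F p q $$ (0, 0) * (T 1 q (\<kappa> 1 q) / T 1 B (\<kappa> 1 B))"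
    by (intro first_column_mult_index[where N = "r + 1"] slice_chain_carrier
        slice_chain_first_column_down[where \<kappa> = \<kappa>] assms(1) le(3) down nz) simp_all
  finally show ?thesis using nz[of B] by simp
qed

section \<open>Descent from the tent to the boundary\<close>

lemma stepped_surface_column_lipschitz:
  assumes "stepped_surface r \<kappa>" "1 \<le> \<alpha>" "\<alpha> \<le> r" "s \<le> t"
  shows "\<bar>\<kappa> \<alpha> t - \<kappa> \<alpha> s\<bar> \<le> t - s"
  using assms(4)
proof (induction t rule: int_ge_induct)
  case (step t)
  then show ?case using stepped_surface_column_step[OF assms(1-3), of t] by linarith
qed simp

lemma stepped_surface_row_lipschitz:
  assumes "stepped_surface r \<kappa>" "1 \<le> \<alpha>" "\<alpha> \<le> r"
  shows "\<kappa> \<alpha> t \<le> \<kappa> 1 t + int \<alpha> - 1"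
  using assms(2,3)
proof (induction \<alpha> rule: nat_induct_at_least)
  case (Suc \<alpha>)
  then show ?case using stepped_surface_row_step[OF assms(1), of \<alpha> t] by simp
qed simp

text \<open>By parity two surfaces either meet at a point or differ by at least 2 there. In the
  latter case they cannot cross in one step, so the minimum follows the lower one.\<close>

lemma stepped_surface_min:
  assumes "stepped_surface r \<kappa>" "stepped_surface r \<kappa>'"
  shows "stepped_surface r (\<lambda>\<alpha> t. min (\<kappa> \<alpha> t) (\<kappa>' \<alpha> t))"
proof -
  have step: "\<bar>min b b' - min a a'\<bar> = 1"
    if "\<bar>b - a\<bar> = 1" "\<bar>b' - a'\<bar> = 1" "even (a - a')" for a a' b b' :: int
  proof -
    have "a = a' \<or> a \<le> a' - 2 \<or> a' \<le> a - 2" using that(3) by presburger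
    then show ?thesis using that(1,2) by linarith
  qed
  have even: "even (\<kappa> \<alpha> t - \<kappa>' \<alpha> t)" if "1 \<le> \<alpha>" "\<alpha> \<le> r" for \<alpha> t
    using stepped_surface_parity[OF assms(1) that, of t] stepped_surface_parity[OF assms(2) that, of t]
    by presburger
  show ?thesis
    unfolding stepped_surface_def
  proof (intro conjI ballI allI)
    show "even (int \<alpha> + t + min (\<kappa> \<alpha> t) (\<kappa>' \<alpha> t))" if "\<alpha> \<in> {1..r}" for \<alpha> t
      using that stepped_surface_parity[OF assms(1), of \<alpha> t] stepped_surface_parity[OF assms(2), of \<alpha> t]
      by (simp add: min_def)
    show "\<bar>min (\<kappa> (\<alpha> + 1) t) (\<kappa>' (\<alpha> + 1) t) - min (\<kappa> \<alpha> t) (\<kappa>' \<alpha> t)\<bar> = 1" if "\<alpha> \<in> {1..<r}" for \<alpha> t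
      using that by (intro step even stepped_surface_row_step[OF assms(1)]
          stepped_surface_row_step[OF assms(2)]) auto
    show "\<bar>min (\<kappa> \<alpha> (t + 1)) (\<kappa>' \<alpha> (t + 1)) - min (\<kappa> \<alpha> t) (\<kappa>' \<alpha> t)\<bar> = 1" if "\<alpha> \<in> {1..r}" for \<alpha> t
      using that by (intro step even stepped_surface_column_step[OF assms(1)]
          stepped_surface_column_step[OF assms(2)]) auto
  qed
qed

text \<open>If two opposite corners differ, they differ by 2, and both other corners have the height
  halfway between. So an admissible diagonal always exists.\<close>

lemma stepped_surface_square:
  assumes "stepped_surface r \<kappa>" "1 \<le> \<alpha>" "\<alpha> < r"
  shows "\<kappa> \<alpha> t = \<kappa> (\<alpha> + 1) (t + 1) \<or> \<kappa> \<alpha> (t + 1) = \<kappa> (\<alpha> + 1) t"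
  using stepped_surface_row_step[OF assms, of t] stepped_surface_row_step[OF assms, of "t + 1"]
    stepped_surface_column_step[OF assms(1,2), of t]
    stepped_surface_column_step[OF assms(1), of "\<alpha> + 1" t] assms(2,3)
  by linarith

text \<open>Row 1 is k - |t - j|, with apex (1, j, k). The summand \<open>int \<alpha> - 1\<close>
  is the maximal growth allowed by \<open>stepped_surface_row_lipschitz\<close>.\<close>

definition tent :: "int \<Rightarrow> int \<Rightarrow> nat \<Rightarrow> int \<Rightarrow> int" where
  "tent j k \<alpha> t = min (t - (j - k)) (j + k - t) + int \<alpha> - 1"

lemma stepped_surface_tent:
  assumes "even (1 + j + k)"
  shows "stepped_surface r (tent j k)"
  unfolding stepped_surface_def
proof (intro conjI ballI allI)
  show "even (int \<alpha> + t + tent j k \<alpha> t)" for \<alpha> t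
    using assms unfolding tent_def min_def by (cases "t - (j - k) \<le> j + k - t"; simp; presburger)
  show "\<bar>tent j k \<alpha> (t + 1) - tent j k \<alpha> t\<bar> = 1" for \<alpha> t
    by (auto simp: tent_def min_def)
qed (simp add: tent_def)

text \<open>A lowest point among those where the surfaces differ works: it is a local minimum, and
  by parity raising it by 2 stays below \<tau>.\<close>

lemma local_minimum_below_surface:
  assumes \<kappa>: "stepped_surface r \<kappa>" and \<tau>: "stepped_surface r \<tau>"
    and le: "\<And>\<alpha> t. 1 \<le> \<alpha> \<Longrightarrow> \<alpha> \<le> r \<Longrightarrow> \<kappa> \<alpha> t \<le> \<tau> \<alpha> t"
    and out: "\<And>\<alpha> t. 1 \<le> \<alpha> \<Longrightarrow> \<alpha> \<le> r \<Longrightarrow> t \<le> A \<or> B \<le> t \<Longrightarrow> \<kappa> \<alpha> t = \<tau> \<alpha> t"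
    and ne: "1 \<le> \<alpha>\<^sub>0" "\<alpha>\<^sub>0 \<le> r" "\<kappa> \<alpha>\<^sub>0 t\<^sub>0 \<noteq> \<tau> \<alpha>\<^sub>0 t\<^sub>0"
  obtains \<alpha> t where "local_minimum r \<kappa> \<alpha> t" "A < t" "t < B" "\<kappa> \<alpha> t + 2 \<le> \<tau> \<alpha> t"
proof -
  define D where "D = {(\<alpha>, t). 1 \<le> \<alpha> \<and> \<alpha> \<le> r \<and> \<kappa> \<alpha> t \<noteq> \<tau> \<alpha> t}"
  have "D \<subseteq> {1..r} \<times> {A..B}"
  proof clarify
    fix \<alpha> t assume "(\<alpha>, t) \<in> D"
    then show "\<alpha> \<in> {1..r} \<and> t \<in> {A..B}" using out[of \<alpha> t] unfolding D_def by (cases "t \<le> A \<or> B \<le> t") auto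
  qed
  then have fin: "finite D" by (rule finite_subset) simp
  have "D \<noteq> {}" using ne by (auto simp: D_def)
  then have "Min ((\<lambda>(\<alpha>, t). \<kappa> \<alpha> t) ` D) \<in> (\<lambda>(\<alpha>, t). \<kappa> \<alpha> t) ` D" using fin by (intro Min_in) auto
  then obtain \<alpha> t where D: "(\<alpha>, t) \<in> D" and Min: "Min ((\<lambda>(\<alpha>, t). \<kappa> \<alpha> t) ` D) = \<kappa> \<alpha> t" by auto
  have minimal: "\<kappa> \<alpha> t \<le> \<kappa> \<beta> s" if "(\<beta>, s) \<in> D" for \<beta> s
    unfolding Min[symmetric] using that fin by (intro Min_le) force+
  have \<alpha>: "1 \<le> \<alpha>" "\<alpha> \<le> r" "\<kappa> \<alpha> t \<noteq> \<tau> \<alpha> t" using D by (auto simp: D_def)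
  have gap: "\<kappa> \<alpha> t + 2 \<le> \<tau> \<alpha> t"
    using le[OF \<alpha>(1,2), of t] \<alpha>(3) stepped_surface_parity[OF \<kappa> \<alpha>(1,2), of t]
      stepped_surface_parity[OF \<tau> \<alpha>(1,2), of t] by presburger
  \<comment> \<open>A neighbour where the surfaces differ is not lower by minimality. Where they
    agree, its height is at least \<open>\<tau> \<alpha> t - 1\<close>, which is at least
    \<open>\<kappa> \<alpha> t + 1\<close>.\<close>
  have nb: "\<kappa> \<beta> s = \<kappa> \<alpha> t + 1"
    if "1 \<le> \<beta>" "\<beta> \<le> r" "\<bar>\<kappa> \<beta> s - \<kappa> \<alpha> t\<bar> = 1" "\<bar>\<tau> \<beta> s - \<tau> \<alpha> t\<bar> = 1" for \<beta> s
  proof (cases "(\<beta>, s) \<in> D")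
    case True
    then show ?thesis using minimal[OF True] that(3) by linarith
  next
    case False
    then have "\<kappa> \<beta> s = \<tau> \<beta> s" using that(1,2) by (simp add: D_def)
    then show ?thesis using that(3,4) gap by linarith
  qed
  have "\<kappa> \<alpha> (t - 1) = \<kappa> \<alpha> t + 1"
    using nb[of \<alpha> "t - 1"] \<alpha> stepped_surface_column_step'[OF \<kappa> \<alpha>(1,2), of t]
      stepped_surface_column_step'[OF \<tau> \<alpha>(1,2), of t] by (simp add: abs_minus_commute)
  moreover have "\<kappa> \<alpha> (t + 1) = \<kappa> \<alpha> t + 1"
    using nb[of \<alpha> "t + 1"] \<alpha> stepped_surface_column_step[OF \<kappa> \<alpha>(1,2), of t]
      stepped_surface_column_step[OF \<tau> \<alpha>(1,2), of t] by simp
  moreover have "\<kappa> (\<alpha> - 1) t = \<kappa> \<alpha> t + 1" if "1 < \<alpha>"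
    using nb[of "\<alpha> - 1" t] \<alpha> that stepped_surface_row_step'[OF \<kappa> that \<alpha>(2), of t]
      stepped_surface_row_step'[OF \<tau> that \<alpha>(2), of t] by (simp add: abs_minus_commute)
  moreover have "\<kappa> (\<alpha> + 1) t = \<kappa> \<alpha> t + 1" if "\<alpha> < r"
    using nb[of "\<alpha> + 1" t] \<alpha> that stepped_surface_row_step[OF \<kappa> \<alpha>(1) that, of t]
      stepped_surface_row_step[OF \<tau> \<alpha>(1) that, of t] by simp
  ultimately have "local_minimum r \<kappa> \<alpha> t" using \<alpha> by (simp add: local_minimum_def)
  moreover have "A < t" "t < B" using out[OF \<alpha>(1,2), of t] \<alpha>(3) by force+
  ultimately show ?thesis using gap that by blast
qed

lemma T_system_eq_slice_chain_below_tent: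
  assumes T: "T_system r T" and "1 \<le> r"
    and nz: "\<And>\<beta> s k. 1 \<le> \<beta> \<Longrightarrow> \<beta> \<le> r \<Longrightarrow> even (int \<beta> + s + k) \<Longrightarrow> T \<beta> s k \<noteq> 0"
    and even: "even (1 + j + k)" and AB: "A \<le> j" "j \<le> B"
    and "stepped_surface r \<kappa>" "admissible_diagonals r \<kappa> d"
    and "\<And>\<alpha> t. 1 \<le> \<alpha> \<Longrightarrow> \<alpha> \<le> r \<Longrightarrow> \<kappa> \<alpha> t \<le> tent j k \<alpha> t"
    and "\<And>\<alpha> t. 1 \<le> \<alpha> \<Longrightarrow> \<alpha> \<le> r \<Longrightarrow> t \<le> A \<or> B \<le> t \<Longrightarrow> \<kappa> \<alpha> t = tent j k \<alpha> t"
  shows "T 1 B (\<kappa> 1 B) * slice_chain r \<kappa> T d A B $$ (0, 0) = T 1 j k"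
  using assms(7-)
\<comment> \<open>The measure is the volume between surface and tent. The diagonals must vary in the
  induction because every mutation replaces them.\<close>
proof (induction "nat (\<Sum>(\<alpha>, t)\<in>{1..r} \<times> {A..B}. tent j k \<alpha> t - \<kappa> \<alpha> t)" arbitrary: \<kappa> d
    rule: less_induct)
  case less
  note \<kappa> = less.prems(1)
  have nz1: "T 1 t (\<kappa> 1 t) \<noteq> 0" for t
    by (rule nz) (use \<open>1 \<le> r\<close> stepped_surface_parity[OF \<kappa>, of 1 t] in auto)
  show ?case
  \<comment> \<open>The ascent stops as soon as row 1 is that of the tent, since the trimming only
    looks at row 1. At p = q = j the remaining chain is empty and the prefactor is the value at the
    apex.\<close>
  proof (cases "\<forall>t. \<kappa> 1 t = tent j k 1 t")
    case True
    then have "\<kappa> 1 = tent j k 1" by auto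
    then have "T 1 B (\<kappa> 1 B) * slice_chain r \<kappa> T d A B $$ (0, 0) =
        T 1 j (\<kappa> 1 j) * slice_chain r \<kappa> T d j j $$ (0, 0)"
      using AB \<open>1 \<le> r\<close> nz1 by (intro slice_chain_entry_trim) (auto simp: tent_def min_def)
    then show ?thesis using True by (simp add: tent_def)
  next
    case False
    then obtain t\<^sub>0 where "\<kappa> 1 t\<^sub>0 \<noteq> tent j k 1 t\<^sub>0" by blast
    with \<kappa> stepped_surface_tent[OF even] less.prems(3,4) \<open>1 \<le> r\<close>
    obtain \<alpha> t where lm: "local_minimum r \<kappa> \<alpha> t" and t: "A < t" "t < B"
      and gap: "\<kappa> \<alpha> t + 2 \<le> tent j k \<alpha> t"
      by - (rule local_minimum_below_surface[of r \<kappa> "tent j k" A B 1 t\<^sub>0]; blast)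
    let ?\<mu> = "mutate \<kappa> \<alpha> t" and ?d = "detour_diagonals d \<alpha> t"
    have \<alpha>: "1 \<le> \<alpha>" "\<alpha> \<le> r" using lm by (auto simp: local_minimum_def)
    have \<mu>_le: "?\<mu> \<beta> s \<le> tent j k \<beta> s" if "1 \<le> \<beta>" "\<beta> \<le> r" for \<beta> s
      using less.prems(3)[OF that] gap by (simp add: mutate_def)
    have "(\<Sum>(\<beta>, s)\<in>{1..r} \<times> {A..B}. tent j k \<beta> s - ?\<mu> \<beta> s) <
        (\<Sum>(\<beta>, s)\<in>{1..r} \<times> {A..B}. tent j k \<beta> s - \<kappa> \<beta> s)"
    proof (rule sum_strict_mono_ex1)
      show "\<exists>x\<in>{1..r} \<times> {A..B}. (case x of (\<beta>, s) \<Rightarrow> tent j k \<beta> s - ?\<mu> \<beta> s) <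
          (case x of (\<beta>, s) \<Rightarrow> tent j k \<beta> s - \<kappa> \<beta> s)"
        using \<alpha> t by (intro bexI[of _ "(\<alpha>, t)"]) (auto simp: mutate_def)
    qed (auto simp: mutate_def)
    moreover have "0 \<le> (\<Sum>(\<beta>, s)\<in>{1..r} \<times> {A..B}. tent j k \<beta> s - ?\<mu> \<beta> s)"
      using \<mu>_le by (intro sum_nonneg) auto
    ultimately have "nat (\<Sum>(\<beta>, s)\<in>{1..r} \<times> {A..B}. tent j k \<beta> s - ?\<mu> \<beta> s) <
        nat (\<Sum>(\<beta>, s)\<in>{1..r} \<times> {A..B}. tent j k \<beta> s - \<kappa> \<beta> s)" by linarith
    then have "T 1 B (?\<mu> 1 B) * slice_chain r ?\<mu> T ?d A B $$ (0, 0) = T 1 j k"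
    proof (rule less.hyps)
      show "stepped_surface r ?\<mu>" by (rule stepped_surface_mutate[OF \<kappa> lm])
      show "admissible_diagonals r ?\<mu> ?d"
        by (rule admissible_detour_diagonals[OF lm less.prems(2)]) simp
      show "?\<mu> \<beta> s = tent j k \<beta> s" if "1 \<le> \<beta>" "\<beta> \<le> r" "s \<le> A \<or> B \<le> s" for \<beta> s
        using less.prems(4)[OF that] that(3) t by (auto simp: mutate_def)
    qed (rule \<mu>_le)
    moreover have "?\<mu> 1 B = \<kappa> 1 B" using t by (simp add: mutate_def)
    moreover have "slice_chain r \<kappa> T d A B = slice_chain r ?\<mu> T ?d A B"
      by (rule slice_chain_mutate[OF T \<kappa> lm nz less.prems(2) t])
    ultimately show ?thesis by simp
  qed
qed

text \<open>Discrete intermediate values: with fixed parity and increments of at most 2, no value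
  can be jumped over.\<close>

lemma even_step_attains_value:
  fixes f :: "int \<Rightarrow> int"
  assumes "a \<le> b" "\<And>i. f (i + 1) \<le> f i + 2" "\<And>i. even (f i - v)" "f a \<le> v" "v \<le> f b"
  shows "\<exists>i. f i = v"
  using assms(1,5)
proof (induction b rule: int_ge_induct)
  case base
  then show ?case using assms(4) by force
next
  case (step b)
  show ?case
  proof (cases "v \<le> f b")
    case False
    then have "f b \<le> v - 2" using assms(3)[of b] by presburger
    then have "f (b + 1) = v" using assms(2)[of b] step.prems by linarith
    then show ?thesis by blast
  qed (use step in blast)
qed

text \<open>Far out only the heights c and c + 1 occur, and finitely many points remain. The bounds
  drive the positivity induction, make the sets defining \<open>j\<^sub>0\<close> and
  \<open>j\<^sub>1\<close> finite, and locate the cut-offs \<open>A\<close> and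
  \<open>B\<close>.\<close>

lemma admissible_boundary_bounded:
  assumes "admissible_boundary r kb"
  obtains m M where "\<And>\<alpha> i. 1 \<le> \<alpha> \<Longrightarrow> \<alpha> \<le> r \<Longrightarrow> m \<le> kb \<alpha> i \<and> kb \<alpha> i \<le> M"
proof -
  obtain c J\<^sub>m J\<^sub>p where
    "\<forall>\<alpha>\<in>{1..r}. \<forall>j. j < J\<^sub>m \<or> j > J\<^sub>p \<longrightarrow> kb \<alpha> j = c + (int \<alpha> + j) mod 2"
    using assms unfolding admissible_boundary_def by blast
  then have flat: "kb \<alpha> j = c + (int \<alpha> + j) mod 2"
    if "1 \<le> \<alpha>" "\<alpha> \<le> r" "j < J\<^sub>m \<or> j > J\<^sub>p" for \<alpha> j using that by auto
  define S where "S = (\<lambda>(\<alpha>, j). kb \<alpha> j) ` ({1..r} \<times> {J\<^sub>m..J\<^sub>p}) \<union> {c, c + 1}"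
  have fin: "finite S" by (simp add: S_def)
  have "kb \<alpha> i \<in> S" if "1 \<le> \<alpha>" "\<alpha> \<le> r" for \<alpha> i
  proof (cases "i < J\<^sub>m \<or> i > J\<^sub>p")
    case True
    have "(int \<alpha> + i) mod 2 = 0 \<or> (int \<alpha> + i) mod 2 = 1" by presburger
    then show ?thesis using flat[OF that True] by (auto simp: S_def)
  next
    case False
    then have "(\<alpha>, i) \<in> {1..r} \<times> {J\<^sub>m..J\<^sub>p}" using that by auto
    then show ?thesis unfolding S_def by (metis (no_types, lifting) UnI1 case_prod_conv image_eqI)
  qed
  then show ?thesis using that[of "Min S" "Max S"] fin by simp
qed

theorem mainTheorem9:
  fixes r :: nat and kb :: "nat \<Rightarrow> int \<Rightarrow> int"
    and T :: "nat \<Rightarrow> int \<Rightarrow> int \<Rightarrow> ratfun"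
    and d :: "int \<Rightarrow> nat \<Rightarrow> diagonal"
    and j k j\<^sub>0 j\<^sub>1 :: int
  assumes "r \<ge> 1"
    and "admissible_boundary r kb"
    and "T_system r T"
    and "\<forall>\<alpha>\<in>{1..r}. \<forall>i. T \<alpha> i (kb \<alpha> i) = avar \<alpha> i"
    and "admissible_diagonals r kb d"
    and "even (1 + j + k)"
    and "k > kb 1 j"
    and "j\<^sub>0 = Max {i. i - kb 1 i = j - k}"
    and "j\<^sub>1 = Min {i. i + kb 1 i = j + k}"
  shows "T 1 j k =
    T 1 j\<^sub>1 (kb 1 j\<^sub>1) *
      foldr (*) (map (slice_matrix r kb T d) [j\<^sub>0..j\<^sub>1 - 1]) (1\<^sub>m (r + 1)) $$ (0, 0)"
proof -
  have kb: "stepped_surface r kb"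
    using assms(2) by (simp add: admissible_boundary_def stepped_surface_def)
  obtain m M where bounds: "\<And>\<alpha> i. 1 \<le> \<alpha> \<Longrightarrow> \<alpha> \<le> r \<Longrightarrow> m \<le> kb \<alpha> i \<and> kb \<alpha> i \<le> M"
    using admissible_boundary_bounded[OF assms(2)] by blast
  have nz: "T \<alpha> i k' \<noteq> 0" if "1 \<le> \<alpha>" "\<alpha> \<le> r" "even (int \<alpha> + i + k')" for \<alpha> i k'
  proof -
    have "T \<alpha> i k' \<in> positive_fracts"
    proof (rule T_system_cone[OF assms(3) kb])
      show "T \<beta> s (kb \<beta> s) \<in> positive_fracts" if "1 \<le> \<beta>" "\<beta> \<le> r" for \<beta> s
        using assms(4) that by (simp add: avar_in_positive_fracts)
      show "m \<le> kb \<beta> s" "kb \<beta> s \<le> M" if "1 \<le> \<beta>" "\<beta> \<le> r" for \<beta> s using bounds[OF that] by auto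
    qed (fact one_in_positive_fracts zero_notin_positive_fracts positive_fracts_add
          positive_fracts_mult positive_fracts_divide that)+
    then show ?thesis using zero_notin_positive_fracts by metis
  qed
  note one = order_refl[of "1::nat"] \<open>1 \<le> r\<close>
  have b1: "m \<le> kb 1 i" "kb 1 i \<le> M" for i using bounds[OF one] by auto
  have step1: "\<bar>kb 1 (i + 1) - kb 1 i\<bar> = 1" for i by (rule stepped_surface_column_step[OF kb one])
  have par1: "even (1 + i + kb 1 i)" for i using stepped_surface_parity[OF kb one, of i] by simp
  have lip: "\<bar>kb 1 t - kb 1 s\<bar> \<le> t - s" if "s \<le> t" for s t
    by (rule stepped_surface_column_lipschitz[OF kb one that])

  \<comment> \<open>\<open>Max\<close> and \<open>Min\<close> yield members only for finite nonempty
    sets. Nonempty: the quantity exceeds j - k at i = j because k > \<open>kb 1 j\<close>, and falls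
    to at most j - k far to the left because \<open>kb\<close> is bounded below.\<close>
  have "\<exists>i. i - kb 1 i = j - k"
  proof (rule even_step_attains_value[of "min j (j - k + m)" j "\<lambda>i. i - kb 1 i"])
    show "min j (j - k + m) - kb 1 (min j (j - k + m)) \<le> j - k" using b1[of "min j (j - k + m)"] by linarith
    show "i + 1 - kb 1 (i + 1) \<le> i - kb 1 i + 2" for i using step1[of i] by linarith
    show "even (i - kb 1 i - (j - k))" for i using par1[of i] assms(6) by presburger
    show "j - k \<le> j - kb 1 j" using assms(7) by simp
  qed simp
  moreover have "{i. i - kb 1 i = j - k} \<subseteq> {j - k + m..j - k + M}"
  proof
    fix i assume "i \<in> {i. i - kb 1 i = j - k}"
    then show "i \<in> {j - k + m..j - k + M}" using b1[of i] by simp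
  qed
  then have "finite {i. i - kb 1 i = j - k}" by (rule finite_subset) simp
  ultimately have "j\<^sub>0 \<in> {i. i - kb 1 i = j - k}" unfolding assms(8) by (intro Max_in) auto
  then have j0: "j\<^sub>0 - kb 1 j\<^sub>0 = j - k" by simp
  have "\<exists>i. i + kb 1 i = j + k"
  proof (rule even_step_attains_value[of j "max j (j + k - m)" "\<lambda>i. i + kb 1 i"])
    show "j + k \<le> max j (j + k - m) + kb 1 (max j (j + k - m))" using b1[of "max j (j + k - m)"] by linarith
    show "i + 1 + kb 1 (i + 1) \<le> i + kb 1 i + 2" for i using step1[of i] by linarith
    show "even (i + kb 1 i - (j + k))" for i using par1[of i] assms(6) by presburger
    show "j + kb 1 j \<le> j + k" using assms(7) by simp
  qed simp
  moreover have "{i. i + kb 1 i = j + k} \<subseteq> {j + k - M..j + k - m}"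
  proof
    fix i assume "i \<in> {i. i + kb 1 i = j + k}"
    then show "i \<in> {j + k - M..j + k - m}" using b1[of i] by simp
  qed
  then have "finite {i. i + kb 1 i = j + k}" by (rule finite_subset) simp
  ultimately have "j\<^sub>1 \<in> {i. i + kb 1 i = j + k}" unfolding assms(9) by (intro Min_in) auto
  then have j1: "j\<^sub>1 + kb 1 j\<^sub>1 = j + k" by simp
  \<comment> \<open>If the column lay right of j, the step bound would force \<open>kb 1 j\<close>
    to be at least k.\<close>
  have j0j: "j\<^sub>0 \<le> j" using lip[of j j\<^sub>0] j0 assms(7) by linarith
  have jj1: "j \<le> j\<^sub>1" using lip[of j\<^sub>1 j] j1 assms(7) by linarith

  define \<kappa> where "\<kappa> = (\<lambda>\<alpha> t. min (tent j k \<alpha> t) (kb \<alpha> t))"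
  have \<kappa>: "stepped_surface r \<kappa>"
    unfolding \<kappa>_def by (rule stepped_surface_min[OF stepped_surface_tent[OF assms(6)] kb])
  \<comment> \<open>From the two end columns, which lie on the flanks of the tent, row 1 of
    \<open>kb\<close> can rise inwards by at most one per step. It stays under both flanks, and the
    slope of the tent carries this to all rows.\<close>
  have inner: "\<kappa> \<alpha> t = kb \<alpha> t" if "1 \<le> \<alpha>" "\<alpha> \<le> r" "j\<^sub>0 \<le> t" "t \<le> j\<^sub>1" for \<alpha> t
  proof -
    have "kb \<alpha> t \<le> tent j k \<alpha> t"
      using stepped_surface_row_lipschitz[OF kb that(1,2), of t] lip[OF that(3)] lip[OF that(4)] j0 j1
      unfolding tent_def by linarith
    then show ?thesis by (simp add: \<kappa>_def)
  qed
  \<comment> \<open>Going outwards from \<open>j\<^sub>0\<close>, the flank drops by exactly one per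
    step and \<open>kb\<close> by at most one, so row 1 of the minimum is the flank itself.\<close>
  have left: "\<kappa> 1 t = t - (j - k)" if "t \<le> j\<^sub>0" for t
    using lip[OF that] j0 j0j that unfolding \<kappa>_def tent_def by (simp add: min_def)
  have right: "\<kappa> 1 t = j + k - t" if "j\<^sub>1 \<le> t" for t
    using lip[OF that] j1 jj1 that unfolding \<kappa>_def tent_def by (simp add: min_def; linarith)
  \<comment> \<open>Left of \<open>m + (j - k) - int r\<close> the tent is below \<open>m\<close>
    even in row r, hence below the boundary; \<open>B\<close> mirrors this.\<close>
  define A where "A = min j\<^sub>0 (m + (j - k) - int r)"
  define B where "B = max j\<^sub>1 (j + k - m + int r)"
  have outer: "\<kappa> \<alpha> t = tent j k \<alpha> t" if "1 \<le> \<alpha>" "\<alpha> \<le> r" "t \<le> A \<or> B \<le> t" for \<alpha> t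
  proof -
    have "tent j k \<alpha> t \<le> kb \<alpha> t"
      using bounds[OF that(1,2), of t] that(2,3) unfolding tent_def A_def B_def by linarith
    then show ?thesis by (simp add: \<kappa>_def)
  qed
  \<comment> \<open>A slice t reads the columns t and t + 1, so the given diagonals remain
    admissible for t < \<open>j\<^sub>1\<close> only; elsewhere any admissible choice does.\<close>
  define d' where "d' = (\<lambda>t \<alpha>. if j\<^sub>0 \<le> t \<and> t < j\<^sub>1 then d t \<alpha>
    else if \<kappa> \<alpha> t = \<kappa> (\<alpha> + 1) (t + 1) then SW_NE else NW_SE)"
  have d': "admissible_diagonals r \<kappa> d'"
    unfolding admissible_diagonals_def
  proof (intro allI ballI)
    fix t \<alpha> assume "\<alpha> \<in> {1..<r}"
    then have \<alpha>: "1 \<le> \<alpha>" "\<alpha> < r" by auto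
    show "(d' t \<alpha> = SW_NE \<longrightarrow> \<kappa> \<alpha> t = \<kappa> (\<alpha> + 1) (t + 1)) \<and> (d' t \<alpha> = NW_SE \<longrightarrow> \<kappa> \<alpha> (t + 1) = \<kappa> (\<alpha> + 1) t)"
    proof (cases "j\<^sub>0 \<le> t \<and> t < j\<^sub>1")
      case True
      then show ?thesis
        using assms(5) \<alpha> inner unfolding admissible_diagonals_def d'_def by simp
    next
      case False
      then show ?thesis using stepped_surface_square[OF \<kappa> \<alpha>, of t] by (auto simp: d'_def)
    qed
  qed

  have "T 1 j k = T 1 B (\<kappa> 1 B) * slice_chain r \<kappa> T d' A B $$ (0, 0)"
  proof (rule T_system_eq_slice_chain_below_tent[OF assms(3,1) nz assms(6) _ _ \<kappa> d' _ outer, symmetric])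
    show "A \<le> j" "j \<le> B" using j0j jj1 by (auto simp: A_def B_def)
    show "\<kappa> \<alpha> t \<le> tent j k \<alpha> t" for \<alpha> t by (simp add: \<kappa>_def)
  qed
  also have "\<dots> = T 1 j\<^sub>1 (\<kappa> 1 j\<^sub>1) * slice_chain r \<kappa> T d' j\<^sub>0 j\<^sub>1 $$ (0, 0)"
  proof (rule slice_chain_entry_trim[OF \<open>1 \<le> r\<close>])
    show "A \<le> j\<^sub>0" "j\<^sub>0 \<le> j\<^sub>1" "j\<^sub>1 \<le> B" using j0j jj1 by (auto simp: A_def B_def)
    show "\<kappa> 1 (t + 1) = \<kappa> 1 t + 1" if "t < j\<^sub>0" for t using left[of t] left[of "t + 1"] that by simp
    show "\<kappa> 1 (t + 1) \<noteq> \<kappa> 1 t + 1" if "j\<^sub>1 \<le> t" for t using right[of t] right[of "t + 1"] that by simp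
    show "T 1 t (\<kappa> 1 t) \<noteq> 0" for t by (rule nz[OF one stepped_surface_parity[OF \<kappa> one]])
  qed
  also have "slice_chain r \<kappa> T d' j\<^sub>0 j\<^sub>1 = slice_chain r kb T d j\<^sub>0 j\<^sub>1"
    by (intro slice_chain_cong slice_matrix_cong inner) (auto simp: d'_def)
  also have "\<kappa> 1 j\<^sub>1 = kb 1 j\<^sub>1" using inner[OF one] j0j jj1 by simp
  finally show ?thesis by (simp add: slice_chain_def)
qed

end
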